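(* Let $a,b$ be positive integers, let $\nu=EN^{a-1}E^{b-1}N$, and let $g=\gcd(a,b)$ and $\ell=\operatorname{lcm}(a,b)$. Let $0\le k\le b-1$, with $k=0$ if $a=1$, and consider rowmotion on $\mathsf{H}_{\delta(k)}(a,b)$. Recall that rowmotion on $\mathsf{H}_{\delta(k)}(a,b)$ has $g-1$ orbits of size $\ell$ and exactly one orbit of size $\ell+1$. Let $\mathcal{O}$ denote any orbit of size $\ell$, and let $\mathcal{O}'$ denote the orbit of size $\ell+1$. Then: (1) $\sum_{z\in\mathcal O}\mathsf{ddeg}(z)=\frac{2ab-a-b}{g}$ and $\sum_{z\in\mathcal O'}\mathsf{ddeg}(z)=\frac{2ab-a-b}{g}+1$. These sums are independent of $\delta(k)$, and $\mathsf{ddeg}$ is homometric under rowmotion. (2) $\sum_{z\in\mathcal O}\mathsf{peak}(z)=\frac{3ab-2a-2b}{g}$ and $\sum_{z\in\mathcal O'}\mathsf{peak}(z)=\frac{3ab-2a-2b}{g}+2$. These sums are independent of $\delta(k)$, and $\mathsf{peak}$ is homometric under rowmotion. (3) $\sum_{z\in\mathcal O}\mathsf{val}(z)=\frac{2ab-a-b}{g}$ and $\sum_{z\in\mathcal O'}\mathsf{val}(z)=\frac{2ab-a-b}{g}+1$. These sums are independent of $\delta(k)$, and $\mathsf{val}$ is homometric under rowmotion. (4) The statistic $\mathsf{area}$ is homometric in the following two cases. When $k=b-1$, $$\sum_{z\in\mathcal O}\mathsf{area}(z)=\ell\Big(\frac{a+b-2}{2}+\frac1a\Big),\qquad \sum_{z\in\mathcal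 O'}\mathsf{area}(z)=\ell\Big(\frac{a+b-2}{2}+\frac1a\Big)+(a-1).$$ When $k=0$, $$\sum_{z\in\mathcal O}\mathsf{area}(z)=\ell\cdot\frac{a+b-2}{2},\qquad \sum_{z\in\mathcal O'}\mathsf{area}(z)=\ell\cdot\frac{a+b-2}{2}+(a+b-1).$$
   Context: A lattice path is a finite word in $N$ (unit north step) and $E$ (unit east step), drawn from the origin; exponents denote repetition. For $\nu=E^{\nu_0}NE^{\nu_1}N\cdots NE^{\nu_n}$, a $\nu$-path is a lattice path with the same endpoints as $\nu$ that stays weakly above $\nu$. An increment vector is an integer vector $\delta=(\delta_1,\dots,\delta_n)$ with $0\le\delta_i\le\nu_i$. The $\delta$-altitude of points on a $\nu$-path $\mu$ is defined recursively: it is $0$ at the start, decreases by $1$ after each $E$ step, and increases by $\delta_i$ after the $i$th $N$ step. A $\delta$-rotation at a valley $EN$ of $\mu$ is defined as follows. Let $x$ be the point between the $E$ and $N$, and let $y$ be the first later point of $\mu$ with the same $\delta$-altitude as $x$. Interchange the subpath from $x$ to $y$ with the $E$ step preceding $x$; this gives $\mu'$. The alt $\nu$-Tamari lattice $\mathrm{Tam}_\delta(\nu)$ is the poset on $\nu$-paths whose cover relations are exactly the $\delta$-rotations $\mu\lessdot\mu'$. It is a finite semidistributive lattice. For $\nu=EN^{a-1}E^{b-1}N$: if $a>1$ then $(\nu_0,\dots,\nu_a)=(1,0,\dots,0,b-1,0)$, and the increment vectors are $\delta(k)=(0,\dots,0,k,0)\in\mathbb{Z}^a$ for $0\le k\le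 b-1$. If $a=1$, the only increment vector is $\delta(0)=(0)$. The alt hook-Tamari lattice is $\mathsf{H}_{\delta}(a,b)=\mathrm{Tam}_\delta(\nu)$. Rowmotion on a finite semidistributive lattice $L$ is defined as follows. Let $\mathrm{Pop}^{\downarrow}(x)=x\wedge\bigwedge\{y: y\lessdot x\}$. Then $\mathrm{Row}(x)$ is the unique maximal element of $\{y\in L: x\wedge y=\mathrm{Pop}^{\downarrow}(x)\}$. Statistics: $\mathsf{ddeg}(p)$ is the number of elements covered by $p$. For a $\nu$-path $\mu$, $\mathsf{peak}(\mu)$ is the number of occurrences of $NE$ in $\mu$, $\mathsf{val}(\mu)$ is the number of occurrences of $EN$, and $\mathsf{area}(\mu)$ is the area of the region between $\mu$ and $\nu$. A statistic is homometric under rowmotion if any two orbits of the same size have the same sum of the statistic. *)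

theory Defs
  imports Complex_Main "HOL-Algebra.Lattice" "HOL-Combinatorics.Orbits"
begin

section \<open>Rowmotion\<close>

text \<open>
  Finite lattices are orders in the sense of HOL-Algebra.  Meets are the library ones
  (\<open>\<Sqinter>\<close> of the empty set is the top element).
\<close>

definition covered_by :: "('a, 'm) gorder_scheme \<Rightarrow> 'a \<Rightarrow> 'a \<Rightarrow> bool" where
  "covered_by L y x \<longleftrightarrow> y \<in> carrier L \<and> x \<in> carrier L \<and> y \<sqsubset>\<^bsub>L\<^esub> x \<and>
     \<not> (\<exists>z\<in>carrier L. y \<sqsubset>\<^bsub>L\<^esub> z \<and> z \<sqsubset>\<^bsub>L\<^esub> x)"

definition ddeg :: "('a, 'm) gorder_scheme \<Rightarrow> 'a \<Rightarrow> nat" where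
  "ddeg L x = card {y. covered_by L y x}"

definition pop_down :: "('a, 'm) gorder_scheme \<Rightarrow> 'a \<Rightarrow> 'a" where
  "pop_down L x = x \<sqinter>\<^bsub>L\<^esub> (\<Sqinter>\<^bsub>L\<^esub> {y. covered_by L y x})"

definition is_maximal :: "('a, 'm) gorder_scheme \<Rightarrow> 'a set \<Rightarrow> 'a \<Rightarrow> bool" where
  "is_maximal L A m \<longleftrightarrow> m \<in> A \<and> \<not> (\<exists>y\<in>A. m \<sqsubset>\<^bsub>L\<^esub> y)"

definition rowmotion :: "('a, 'm) gorder_scheme \<Rightarrow> 'a \<Rightarrow> 'a" where
  "rowmotion L x =
     (THE m. is_maximal L {y \<in> carrier L. x \<sqinter>\<^bsub>L\<^esub> y = pop_down L x} m)"

definition row_orbits :: "('a, 'm) gorder_scheme \<Rightarrow> 'a set set" where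
  "row_orbits L = orbit (rowmotion L) ` carrier L"

text \<open>
  Orbits of equal size, one in each of two lattices, have equal sums of the statistics.
  With both lattices and both statistics equal this is homometry under rowmotion.
\<close>

definition same_orbit_sums ::
  "('a, 'm) gorder_scheme \<Rightarrow> ('a \<Rightarrow> nat) \<Rightarrow> ('a, 'm) gorder_scheme \<Rightarrow> ('a \<Rightarrow> nat) \<Rightarrow> bool"
where
  "same_orbit_sums L f L' f' \<longleftrightarrow>
     (\<forall>Q\<in>row_orbits L. \<forall>Q'\<in>row_orbits L'.
        card Q = card Q' \<longrightarrow> (\<Sum>z\<in>Q. f z) = (\<Sum>z\<in>Q'. f' z))"

definition homometric :: "('a, 'm) gorder_scheme \<Rightarrow> ('a \<Rightarrow> nat) \<Rightarrow> bool" where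
  "homometric L f \<longleftrightarrow> same_orbit_sums L f L f"


section \<open>Lattice paths\<close>

datatype step = N | E

type_synonym path = "step list"

text \<open>
  The number of north steps lying weakly to the left of the vertical line at \<open>x\<close>.
  If the path has an east step from abscissa \<open>x\<close> to \<open>x + 1\<close>, this is its ordinate.
\<close>

definition height :: "path \<Rightarrow> nat \<Rightarrow> nat" where
  "height p x = card {i. i < length p \<and> p ! i = N \<and> count_list (take i p) E \<le> x}"

definition weakly_above :: "path \<Rightarrow> path \<Rightarrow> bool" where
  "weakly_above \<mu> \<nu> \<longleftrightarrow> (\<forall>x < count_list \<nu> E. height \<nu> x \<le> height \<mu> x)"

definition nu_paths :: "path \<Rightarrow> path set" where
  "nu_paths \<nu> = {\<mu>. count_list \<mu> E = count_list \<nu> E \<and> count_list \<mu> N = count_list \<nu> N \<and>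
                     weakly_above \<mu> \<nu>}"

definition peak :: "path \<Rightarrow> nat" where
  "peak \<mu> = card {i. Suc i < length \<mu> \<and> \<mu> ! i = N \<and> \<mu> ! Suc i = E}"

definition val :: "path \<Rightarrow> nat" where
  "val \<mu> = card {i. Suc i < length \<mu> \<and> \<mu> ! i = E \<and> \<mu> ! Suc i = N}"

text \<open>
  The area between \<open>\<mu>\<close> and \<open>\<nu>\<close>, as the number of unit squares
  between them; \<open>(x, y)\<close> is the lower left corner of the square.
\<close>

definition area :: "path \<Rightarrow> path \<Rightarrow> nat" where
  "area \<nu> \<mu> = card {(x, y). x < count_list \<nu> E \<and> height \<nu> x \<le> y \<and> y < height \<mu> x}"


section \<open>Alt \<open>\<nu>\<close>-Tamari lattices\<close>

text \<open>
  \<open>altitude \<delta> \<mu> i\<close> is the \<open>\<delta>\<close>-altitude of the point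
  of \<open>\<mu>\<close> reached after \<open>i\<close> steps.  Lists are indexed from 0, so the
  entry of \<open>\<delta>\<close> belonging to a north step is found at the number of earlier north steps.
\<close>

primrec altitude :: "int list \<Rightarrow> path \<Rightarrow> nat \<Rightarrow> int" where
  "altitude \<delta> \<mu> 0 = 0"
| "altitude \<delta> \<mu> (Suc i) =
     (case \<mu> ! i of
        E \<Rightarrow> altitude \<delta> \<mu> i - 1
      | N \<Rightarrow> altitude \<delta> \<mu> i + \<delta> ! count_list (take i \<mu>) N)"

text \<open>
  The valley consists of the steps \<open>i\<close> and \<open>Suc i\<close>; the points \<open>x\<close> and
  \<open>y\<close> are those reached after \<open>Suc i\<close> and \<open>j\<close> steps.
\<close>

definition rotation :: "int list \<Rightarrow> path \<Rightarrow> path \<Rightarrow> bool" where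
  "rotation \<delta> \<mu> \<mu>' \<longleftrightarrow>
     (\<exists>i j. Suc i < length \<mu> \<and> \<mu> ! i = E \<and> \<mu> ! Suc i = N \<and>
        Suc i < j \<and> j \<le> length \<mu> \<and> altitude \<delta> \<mu> j = altitude \<delta> \<mu> (Suc i) \<and>
        (\<forall>m. Suc i < m \<and> m < j \<longrightarrow> altitude \<delta> \<mu> m \<noteq> altitude \<delta> \<mu> (Suc i)) \<and>
        \<mu>' = take i \<mu> @ drop (Suc i) (take j \<mu>) @ [E] @ drop j \<mu>)"

definition Tam :: "int list \<Rightarrow> path \<Rightarrow> path gorder" where
  "Tam \<delta> \<nu> =
     \<lparr> carrier = nu_paths \<nu>,
       eq = (=),
       le = (\<lambda>p q. p \<in> nu_paths \<nu> \<and> q \<in> nu_paths \<nu> \<and> rotation \<delta> p q)\<^sup>*\<^sup>* \<rparr>"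

definition hook :: "nat \<Rightarrow> nat \<Rightarrow> path" where
  "hook a b = [E] @ replicate (a - 1) N @ replicate (b - 1) E @ [N]"

definition hook_delta :: "nat \<Rightarrow> nat \<Rightarrow> int list" where
  "hook_delta a k = (if a = 1 then [0] else replicate (a - 2) 0 @ [int k, 0])"

definition alt_hook_Tamari :: "nat \<Rightarrow> nat \<Rightarrow> nat \<Rightarrow> path gorder" where
  "alt_hook_Tamari a b k = Tam (hook_delta a k) (hook a b)"

end

theory Submission
  imports Defs
begin

text \<open>
  A path above the hook is either \<open>N\<^sup>A E\<^sup>w N E\<^sup>b\<^sup>-\<^sup>w\<close> with \<open>A = a - 1\<close>, or
  \<open>N\<^sup>A\<^sup>-\<^sup>u E N\<^sup>u E\<^sup>v N E\<^sup>b\<^sup>-\<^sup>1\<^sup>-\<^sup>v\<close> with \<open>u > 0\<close>.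
  Give the first kind the coordinates \<open>(0, w)\<close> and the second kind \<open>(u, w)\<close>, where \<open>w\<close> is \<open>v\<close>
  shifted so as to skip the value \<open>k\<close>.  Then the lattice is the reversed product order on the points
  \<open>(u, w)\<close> with \<open>w = k \<longrightarrow> u = 0\<close>: a product of two chains with one additional element
  \<open>(0, k)\<close>.  Identifying the other elements with \<open>\<int>/a \<times> \<int>/b\<close> through \<open>(u, v)\<close>, rowmotion is the
  translation by \<open>(1, 1)\<close>, except that the additional element is inserted just before \<open>(u, v) = (0, k)\<close>.
  All orbits of the translation have \<open>lcm a b\<close> elements and meet every row, and every column, equally
  often.  On the torus each statistic (the area only for \<open>k = 0\<close> and \<open>k = b - 1\<close>) is a function of \<open>u\<close>
  plus a function of \<open>v\<close>, up to a correction at the single point \<open>(0, k)\<close>, which always lies in the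
  large orbit.
\<close>

section \<open>Orbits of a torus rotation with one inserted point\<close>

definition torus_step :: "nat \<Rightarrow> nat \<Rightarrow> nat \<times> nat \<Rightarrow> nat \<times> nat" where
  "torus_step a b = (\<lambda>(u, v). (Suc u mod a, Suc v mod b))"

lemma torus_step_funpow:
  assumes "u < a" "v < b"
  shows "(torus_step a b ^^ n) (u, v) = ((u + n) mod a, (v + n) mod b)"
  using assms by (induction n) (simp_all add: torus_step_def mod_Suc_eq)

text \<open>The translation is the identity after \<open>lcm a b\<close> steps, so its first
  \<open>lcm a b\<close> iterates exhaust the orbit.\<close>

lemma torus_orbit:
  assumes "u < a" "v < b"
  shows "orbit (torus_step a b) (u, v) = (\<lambda>n. ((u + n) mod a, (v + n) mod b)) ` {..<lcm a b}"
proof -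
  have "(torus_step a b ^^ lcm a b) (u, v) = (u, v)"
    using assms by (simp add: torus_step_funpow mod_add_eq[symmetric] dvd_imp_mod_0)
  moreover have "0 < lcm a b" using assms by (simp add: lcm_pos_nat)
  ultimately have "orbit (torus_step a b) (u, v) = {(torus_step a b ^^ m) (u, v) |m. m < lcm a b}"
    by (rule orbit_altdef_bounded)
  then show ?thesis using assms by (auto simp: torus_step_funpow)
qed

text \<open>If two exponents have the same image, both \<open>a\<close> and \<open>b\<close> divide
  their difference, hence so does \<open>lcm a b\<close>, which is larger than that difference. This
  makes \<open>lcm a b\<close> the exact size of every torus orbit.\<close>

lemma inj_on_torus_orbit:
  "inj_on (\<lambda>n. ((u + n) mod a, (v + n) mod b)) {..<lcm a b :: nat}"
proof -
  have "m = n" if "m \<le> n" "n < lcm a b" "(u + m) mod a = (u + n) mod a" "(v + m) mod b = (v + n) mod b"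
    for m n :: nat
  proof -
    have "a dvd n - m" "b dvd n - m"
      using that by (metis add_le_cancel_left diff_add_inverse2 diff_cancel2 mod_eq_dvd_iff_nat
          add.commute)+
    then have "lcm a b dvd n - m" by simp
    moreover have "n - m < lcm a b" using that by simp
    ultimately show ?thesis using that by (metis dvd_imp_le diff_is_0_eq le_antisym not_le gr0I)
  qed
  then show ?thesis
    by (intro inj_onI) (metis Pair_inject lessThan_iff nat_le_linear)
qed

lemma sum_lessThan_add:
  fixes h :: "nat \<Rightarrow> real"
  shows "(\<Sum>n<m + a. h n) = (\<Sum>n<m. h n) + (\<Sum>n<a. h (m + n))"
  by (induction a) simp_all

lemma sum_mod_shift:
  fixes F :: "nat \<Rightarrow> real"
  assumes "0 < a"
  shows "(\<Sum>n<a. F ((u + n) mod a)) = (\<Sum>n<a. F n)"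
proof -
  have "inj_on (\<lambda>n. (u + n) mod a) {..<a}"
  proof (rule inj_onI)
    fix m n assume "m \<in> {..<a}" "n \<in> {..<a}" "(u + m) mod a = (u + n) mod a"
    \<comment> \<open>Both moduli are taken to be \<open>a\<close>, so that the bound
      \<open>lcm a a\<close> is \<open>a\<close>.\<close>
    then show "m = n" using inj_onD[OF inj_on_torus_orbit[of u a u a], of m n] by simp
  qed
  moreover have "(\<lambda>n. (u + n) mod a) ` {..<a} \<subseteq> {..<a}" using assms by auto
  ultimately have "bij_betw (\<lambda>n. (u + n) mod a) {..<a} {..<a}"
    by (simp add: bij_betw_def endo_inj_surj)
  then show ?thesis by (rule sum.reindex_bij_betw)
qed

lemma sum_mod_periodic:
  fixes F :: "nat \<Rightarrow> real"
  assumes "0 < a"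
  shows "(\<Sum>n<q * a. F ((u + n) mod a)) = real q * (\<Sum>n<a. F n)"
proof (induction q)
  case (Suc q)
  have "(\<Sum>n<Suc q * a. F ((u + n) mod a)) =
      (\<Sum>n<q * a. F ((u + n) mod a)) + (\<Sum>n<a. F ((u + (q * a + n)) mod a))"
    using sum_lessThan_add[of "\<lambda>n. F ((u + n) mod a)" "q * a" a] by (simp only: mult_Suc add.commute)
  also have "(\<Sum>n<a. F ((u + (q * a + n)) mod a)) = (\<Sum>n<a. F n)"
    using sum_mod_shift[OF assms, of F "u + q * a"] by (simp add: add.assoc)
  finally show ?case using Suc by (simp add: algebra_simps)
qed simp

text \<open>Along an orbit the first coordinate runs \<open>lcm a b / a\<close> times through all
  residues and the second one \<open>lcm a b / b\<close> times. Hence a function of \<open>u\<close>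
  plus a function of \<open>v\<close> has the same total on every orbit.\<close>

lemma sum_torus_orbit:
  fixes F G :: "nat \<Rightarrow> real"
  assumes "u < a" "v < b"
  shows "(\<Sum>z\<in>orbit (torus_step a b) (u, v). F (fst z) + G (snd z)) =
    real (lcm a b) / real a * (\<Sum>n<a. F n) + real (lcm a b) / real b * (\<Sum>n<b. G n)"
proof -
  have pos: "0 < a" "0 < b" using assms by auto
  obtain p q where pq: "lcm a b = p * a" "lcm a b = q * b"
    by (metis dvd_def dvd_lcm1 dvd_lcm2 mult.commute)
  have "(\<Sum>z\<in>orbit (torus_step a b) (u, v). F (fst z) + G (snd z)) =
      (\<Sum>n<lcm a b. F ((u + n) mod a)) + (\<Sum>n<lcm a b. G ((v + n) mod b))"
    unfolding torus_orbit[OF assms] sum.reindex[OF inj_on_torus_orbit] by (simp add: sum.distrib)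
  also have "(\<Sum>n<lcm a b. F ((u + n) mod a)) = real p * (\<Sum>n<a. F n)"
    unfolding pq(1) by (rule sum_mod_periodic[OF pos(1)])
  also have "(\<Sum>n<lcm a b. G ((v + n) mod b)) = real q * (\<Sum>n<b. G n)"
    unfolding pq(2) by (rule sum_mod_periodic[OF pos(2)])
  also have "real p = real (lcm a b) / real a" using pq(1) pos by simp
  also have "real q = real (lcm a b) / real b" using pq(2) pos by simp
  finally show ?thesis .
qed

text \<open>Puts the orbit totals over the common denominator \<open>gcd a b\<close>.\<close>

lemma real_lcm_div:
  assumes "0 < a" "0 < b"
  shows "real (lcm a b) / real a = real b / real (gcd a b)" "real (lcm a b) / real b = real a / real (gcd a b)"
proof -
  have "real a * real b = real (gcd a b) * real (lcm a b)"
    by (metis of_nat_mult prod_gcd_lcm_nat)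
  moreover have "gcd a b \<noteq> 0" using assms by simp
  ultimately show "real (lcm a b) / real a = real b / real (gcd a b)"
    "real (lcm a b) / real b = real a / real (gcd a b)"
    using assms by (simp_all add: frac_eq_eq mult.commute)
qed

text \<open>\<open>R\<close> is the translation carried over by \<open>\<phi>\<close>, with the
  arrow into \<open>(0, k)\<close> split in two by \<open>M\<close>. Orbits are counted and summed
  here without reference to a lattice.\<close>

locale torus_insertion =
  fixes a b k :: nat and \<phi> :: "nat \<times> nat \<Rightarrow> 'a" and M :: 'a and R :: "'a \<Rightarrow> 'a"
  assumes pos: "0 < a" "k < b"
    and inj: "inj_on \<phi> ({..<a} \<times> {..<b})"
    and fresh: "M \<notin> \<phi> ` ({..<a} \<times> {..<b})"
    and R_M: "R M = \<phi> (0, k)"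
    and R_\<phi>: "z \<in> {..<a} \<times> {..<b} \<Longrightarrow>
      R (\<phi> z) = (if torus_step a b z = (0, k) then M else \<phi> (torus_step a b z))"
begin

abbreviation "Y \<equiv> {..<a} \<times> {..<b}"
abbreviation "T \<equiv> torus_step a b"
abbreviation "C \<equiv> insert M (\<phi> ` Y)"

lemma T_in: "z \<in> Y \<Longrightarrow> T z \<in> Y"
  by (cases z) (use pos in \<open>auto simp: torus_step_def\<close>)

lemma orbit_T_in: "z \<in> orbit T y \<Longrightarrow> y \<in> Y \<Longrightarrow> z \<in> Y"
  by (induction rule: orbit.induct) (simp_all only: T_in)

text \<open>\<open>orbit f x\<close> starts with \<open>f x\<close>, so that \<open>y\<close>
  belongs to its own orbit expresses that the translation returns to \<open>y\<close>.\<close>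

lemma self_in_orbit_T: "y \<in> Y \<Longrightarrow> y \<in> orbit T y"
proof -
  assume "y \<in> Y"
  then obtain u v where y: "y = (u, v)" "u < a" "v < b" by auto
  moreover from y have "0 < lcm a b" by (simp add: lcm_pos_nat)
  ultimately show ?thesis by (auto simp: torus_orbit intro!: image_eqI[of _ _ 0])
qed

text \<open>The right-hand side is closed under \<open>R\<close>, which bounds the orbit from above.
  Conversely, each step of \<open>T\<close> is one step of \<open>R\<close>, or two steps when it
  passes through \<open>M\<close>.\<close>

lemma orbit_R_\<phi>:
  assumes "y \<in> Y"
  shows "orbit R (\<phi> y) = \<phi> ` orbit T y \<union> (if (0, k) \<in> orbit T y then {M} else {})" (is "_ = ?D")
proof
  have closed: "R x \<in> ?D" if "x \<in> ?D" for x
  proof -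
    from that consider z where "x = \<phi> z" "z \<in> orbit T y" | "x = M" "(0, k) \<in> orbit T y"
      by (auto split: if_splits)
    then show ?thesis
    proof cases
      case 1
      then have "T z \<in> orbit T y" by (simp add: orbit.step)
      with 1 R_\<phi>[of z] orbit_T_in[OF _ assms, of z] show ?thesis by auto
    qed (simp add: R_M)
  qed
  show "orbit R (\<phi> y) \<subseteq> ?D"
  proof
    fix x assume "x \<in> orbit R (\<phi> y)"
    then show "x \<in> ?D"
    proof induction
      case base
      have "\<phi> y \<in> ?D" using self_in_orbit_T[OF assms] by blast
      then show ?case by (rule closed)
    qed (rule closed)
  qed
  have reach: "M \<in> orbit R (\<phi> y) \<Longrightarrow> \<phi> (0, k) \<in> orbit R (\<phi> y)"
    using orbit.step[of M R "\<phi> y"] by (simp add: R_M)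
  \<comment> \<open>The second conjunct records the visit to \<open>M\<close> on the way into
    \<open>(0, k)\<close>; the induction would otherwise lose it.\<close>
  have "\<phi> z \<in> orbit R (\<phi> y) \<and> (z = (0, k) \<longrightarrow> M \<in> orbit R (\<phi> y))" if "z \<in> orbit T y" for z
    using that
  proof induction
    case base
    show ?case using orbit.base[of R "\<phi> y"] R_\<phi>[OF assms] reach by (auto split: if_splits)
  next
    case (step z)
    then have "R (\<phi> z) \<in> orbit R (\<phi> y)" by (simp add: orbit.step)
    with R_\<phi>[OF orbit_T_in[OF step.hyps assms]] reach show ?case by (auto split: if_splits)
  qed
  then show "?D \<subseteq> orbit R (\<phi> y)" by (simp add: image_subset_iff)
qed

text \<open>The orbit of \<open>R M\<close> passes through \<open>M\<close>, so \<open>M\<close> is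
  a periodic point and has the same orbit as its image.\<close>

lemma orbit_R_M: "orbit R M = insert M (\<phi> ` orbit T (0, k))"
proof -
  have 0: "(0, k) \<in> Y" using pos by auto
  have *: "orbit R (\<phi> (0, k)) = insert M (\<phi> ` orbit T (0, k))"
    using orbit_R_\<phi>[OF 0] self_in_orbit_T[OF 0] by simp
  then have "M \<in> orbit R (R M)" by (simp add: R_M)
  then have "M \<in> orbit R M" by (rule orbit_subset)
  then have "orbit R (R M) = orbit R M" by (rule self_in_orbit_step)
  with * show ?thesis by (simp add: R_M)
qed

lemma orbit_T_eq: "y \<in> Y \<Longrightarrow> z \<in> orbit T y \<Longrightarrow> orbit T z = orbit T y"
  by (rule orbit_cyclic_eq3[OF cyclic_on_singleI[OF self_in_orbit_T refl]])

lemma orbit_cases: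
  assumes "Q \<in> orbit R ` C"
  obtains (small) y where "y \<in> Y" "Q = \<phi> ` orbit T y" "(0, k) \<notin> orbit T y" "M \<notin> Q"
  | (large) "Q = insert M (\<phi> ` orbit T (0, k))"
proof -
  from assms consider "Q = orbit R M" | y where "y \<in> Y" "Q = orbit R (\<phi> y)" by auto
  then show thesis
  proof cases
    case 1
    then show ?thesis using large orbit_R_M by simp
  next
    case 2
    show ?thesis
    proof (cases "(0, k) \<in> orbit T y")
      case True
      then show ?thesis using large orbit_R_\<phi>[of y] orbit_T_eq[of y "(0, k)"] 2 by simp
    next
      case False
      have "\<phi> ` orbit T y \<subseteq> \<phi> ` Y" using orbit_T_in[OF _ 2(1)] by blast
      then have "M \<notin> \<phi> ` orbit T y" using fresh by blast
      with False show ?thesis using small[of y] orbit_R_\<phi>[of y] 2 by simp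
    qed
  qed
qed

lemma card_orbit_T: "y \<in> Y \<Longrightarrow> card (\<phi> ` orbit T y) = lcm a b"
proof -
  assume y: "y \<in> Y"
  have "inj_on \<phi> (orbit T y)" using inj orbit_T_in[OF _ y] by (meson inj_on_subset subsetI)
  moreover obtain u v where "y = (u, v)" "u < a" "v < b" using y by auto
  then have "card (orbit T y) = lcm a b"
    by (simp add: torus_orbit card_image[OF inj_on_torus_orbit])
  ultimately show ?thesis by (simp add: card_image)
qed

lemma M_fresh: "M \<notin> \<phi> ` orbit T (0, k)"
proof
  assume "M \<in> \<phi> ` orbit T (0, k)"
  then obtain z where "z \<in> orbit T (0, k)" "M = \<phi> z" by (rule imageE)
  moreover have "(0, k) \<in> Y" using pos by auto
  ultimately show False using orbit_T_in fresh by (metis image_eqI)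
qed

lemma finite_orbit_T: "y \<in> Y \<Longrightarrow> finite (orbit T y)"
  by (intro finite_orbit self_in_orbit_T)

lemma card_orbit_R:
  assumes "Q \<in> orbit R ` C"
  shows "card Q = (if M \<in> Q then Suc (lcm a b) else lcm a b)"
  using assms
proof (cases rule: orbit_cases)
  case large
  have "(0, k) \<in> Y" using pos by auto
  with large show ?thesis using card_orbit_T[of "(0, k)"] M_fresh finite_orbit_T[of "(0,k)"] by simp
qed (use card_orbit_T in auto)

lemma orbit_R_with_M:
  assumes "Q \<in> orbit R ` C" "M \<in> Q"
  shows "Q = orbit R M"
  using assms(1)
proof (cases rule: orbit_cases)
  case large
  then show ?thesis unfolding orbit_R_M .
qed (use assms(2) in simp)

text \<open>Any two orbits that meet coincide. This is inherited from the cyclic orbits of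
  \<open>T\<close> through the explicit description of the orbits of \<open>R\<close>.\<close>

lemma orbit_R_eq:
  assumes "x \<in> C" "z \<in> orbit R x"
  shows "z \<in> C \<and> orbit R z = orbit R x"
proof -
  have Q: "orbit R x \<in> orbit R ` C" using assms by blast
  from Q show ?thesis
  proof (cases rule: orbit_cases)
    case (small y)
    then obtain w where w: "w \<in> orbit T y" "z = \<phi> w" using assms by auto
    then have "w \<in> Y" "orbit T w = orbit T y" using small orbit_T_in orbit_T_eq by blast+
    then show ?thesis using small orbit_R_\<phi>[of w] w by auto
  next
    case large
    have 0: "(0, k) \<in> Y" using pos by auto
    from large assms consider "z = M" | w where "z = \<phi> w" "w \<in> orbit T (0, k)" by auto
    then show ?thesis
    proof cases
      case 1
      then show ?thesis using large orbit_R_M by simp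
    next
      case 2
      then have "w \<in> Y" "orbit T w = orbit T (0, k)"
        using orbit_T_in[OF _ 0] orbit_T_eq[OF 0] by blast+
      then show ?thesis using large orbit_R_\<phi>[of w] 2 self_in_orbit_T[OF 0] by auto
    qed
  qed
qed

lemma self_in_orbit_R: "x \<in> C \<Longrightarrow> x \<in> orbit R x"
  by (auto simp: orbit_R_M orbit_R_\<phi> self_in_orbit_T)

text \<open>Double counting: the orbits partition the \<open>a * b + 1\<close> points into classes
  of size \<open>lcm a b\<close>, except that the class of \<open>M\<close> has one more. Comparison
  with \<open>a * b = gcd a b * lcm a b\<close> gives the number of classes.\<close>

lemma card_orbits_R: "card (orbit R ` C) = gcd a b"
proof -
  let ?O = "orbit R ` C"
  have Un: "\<Union>?O = C"
  proof
    show "\<Union>?O \<subseteq> C" using orbit_R_eq by (meson UN_least subsetI)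
    show "C \<subseteq> \<Union>?O" using self_in_orbit_R by (meson UN_I subsetI)
  qed
  have fin: "finite C" by simp
  have disj: "disjoint ?O"
  proof (rule disjointI)
    fix Q Q' assume "Q \<in> ?O" "Q' \<in> ?O" "Q \<noteq> Q'"
    then obtain x x' where x: "x \<in> C" "x' \<in> C" "Q = orbit R x" "Q' = orbit R x'" by (elim imageE)
    show "Q \<inter> Q' = {}"
    proof (rule ccontr)
      assume "Q \<inter> Q' \<noteq> {}"
      then obtain z where "z \<in> orbit R x" "z \<in> orbit R x'" using x by blast
      then have "orbit R z = Q" "orbit R z = Q'" using orbit_R_eq x by blast+
      then have "Q = Q'" by simp
      with \<open>Q \<noteq> Q'\<close> show False ..
    qed
  qed
  have finO: "finite Q" if "Q \<in> ?O" for Q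
    using Union_upper[OF that] unfolding Un by (rule finite_subset[OF _ fin])
  have "card C = (\<Sum>Q\<in>?O. card Q)"
    using card_Union_disjoint[OF disj finO] unfolding Un .
  also have "\<dots> = (\<Sum>Q\<in>?O. lcm a b + (if Q = orbit R M then 1 else 0))"
  proof (rule sum.cong)
    fix Q assume "Q \<in> ?O"
    moreover from this have "M \<in> Q \<longleftrightarrow> Q = orbit R M"
      using self_in_orbit_R[of M] orbit_R_with_M[of Q] by blast
    ultimately show "card Q = lcm a b + (if Q = orbit R M then 1 else 0)"
      using card_orbit_R[of Q] by simp
  qed simp
  also have "\<dots> = card ?O * lcm a b + 1"
    by (simp only: sum.distrib sum.delta finO finite_imageI fin) simp
  also have "card C = a * b + 1"
    using fresh inj by (simp add: card_image)
  finally have "a * b = card ?O * lcm a b" by simp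
  moreover have "a * b = gcd a b * lcm a b" by (rule prod_gcd_lcm_nat)
  moreover have "lcm a b \<noteq> 0" using pos by simp
  ultimately show ?thesis by (metis mult_right_cancel)
qed

text \<open>The defect \<open>c\<close> sits at \<open>(0, k)\<close>, and the orbit through
  \<open>\<phi> (0, k)\<close> is the one through \<open>M\<close>. So the large orbit alone
  collects \<open>c\<close> and the value at \<open>M\<close>.\<close>

lemma sum_orbit_R:
  fixes f :: "'a \<Rightarrow> real"
  assumes f: "\<And>u v. u < a \<Longrightarrow> v < b \<Longrightarrow> f (\<phi> (u, v)) = F u + G v + (if (u, v) = (0, k) then c else 0)"
    and Q: "Q \<in> orbit R ` C"
  shows "sum f Q = real (lcm a b) / real a * (\<Sum>n<a. F n) + real (lcm a b) / real b * (\<Sum>n<b. G n)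
    + (if M \<in> Q then c + f M else 0)"
proof -
  have *: "sum f (\<phi> ` orbit T y) = real (lcm a b) / real a * (\<Sum>n<a. F n) +
      real (lcm a b) / real b * (\<Sum>n<b. G n) + (if (0, k) \<in> orbit T y then c else 0)" if y: "y \<in> Y" for y
  proof -
    have "inj_on \<phi> (orbit T y)" using inj orbit_T_in[OF _ y] by (meson inj_on_subset subsetI)
    then have "sum f (\<phi> ` orbit T y) = (\<Sum>z\<in>orbit T y. f (\<phi> z))" by (simp add: sum.reindex)
    also have "\<dots> = (\<Sum>z\<in>orbit T y. (F (fst z) + G (snd z)) + (if z = (0, k) then c else 0))"
    proof (rule sum.cong)
      fix z assume "z \<in> orbit T y"
      then have "z \<in> Y" using y orbit_T_in by blast
      then show "f (\<phi> z) = (F (fst z) + G (snd z)) + (if z = (0, k) then c else 0)"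
        using f by (cases z) auto
    qed simp
    also have "\<dots> = (\<Sum>z\<in>orbit T y. F (fst z) + G (snd z)) + (if (0, k) \<in> orbit T y then c else 0)"
      using finite_orbit_T[OF y] by (simp add: sum.distrib)
    finally show ?thesis using sum_torus_orbit[of "fst y" a "snd y" b F G] y by auto
  qed
  from Q show ?thesis
  proof (cases rule: orbit_cases)
    case (small y)
    then show ?thesis using *[of y] by simp
  next
    case large
    have 0: "(0, k) \<in> Y" using pos by auto
    show ?thesis
      using large *[OF 0] M_fresh finite_orbit_T[OF 0] self_in_orbit_T[OF 0] by simp
  qed
qed

lemma orbit_size_counts:
  shows "Q \<in> orbit R ` C \<Longrightarrow> card Q = lcm a b \<or> card Q = lcm a b + 1"
    and "card {Q \<in> orbit R ` C. card Q = lcm a b} = gcd a b - 1"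
    and "card {Q \<in> orbit R ` C. card Q = lcm a b + 1} = 1"
proof -
  let ?O = "orbit R ` C"
  show "Q \<in> ?O \<Longrightarrow> card Q = lcm a b \<or> card Q = lcm a b + 1"
    using card_orbit_R[of Q] by (cases "M \<in> Q") simp_all
  have O: "orbit R M \<in> ?O" by (rule imageI) simp
  have large: "card Q = lcm a b + 1 \<longleftrightarrow> Q = orbit R M"
    and small: "card Q = lcm a b \<longleftrightarrow> Q \<noteq> orbit R M" if "Q \<in> ?O" for Q
  proof -
    have M: "M \<in> Q \<longleftrightarrow> Q = orbit R M"
    proof
      show "Q = orbit R M" if "M \<in> Q" using orbit_R_with_M[OF \<open>Q \<in> ?O\<close> that] .
      show "M \<in> Q" if "Q = orbit R M" unfolding that by (rule self_in_orbit_R) (rule insertI1)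
    qed
    show "card Q = lcm a b + 1 \<longleftrightarrow> Q = orbit R M" "card Q = lcm a b \<longleftrightarrow> Q \<noteq> orbit R M"
      unfolding M[symmetric] card_orbit_R[OF that] by simp_all
  qed
  have "{Q \<in> ?O. card Q = lcm a b + 1} = {orbit R M}"
    using large O by blast
  then show "card {Q \<in> ?O. card Q = lcm a b + 1} = 1" by simp
  have "{Q \<in> ?O. card Q = lcm a b} = ?O - {orbit R M}"
    using small by blast
  then show "card {Q \<in> ?O. card Q = lcm a b} = gcd a b - 1"
    using card_Diff_singleton[OF O] unfolding card_orbits_R by (simp only:)
qed

end

section \<open>Rowmotion on a grid with one inserted point\<close>

lemma sum_of_bool_less_top: "(\<Sum>u\<le>A. of_bool (u < A)) = real A"
  by (simp add: lessThan_Suc_atMost[symmetric] of_bool_def)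

lemma sum_of_bool_less_pred: "0 < b \<Longrightarrow> (\<Sum>v<b. of_bool (v < b - 1)) = real b - 1"
  by (cases b) (simp_all add: of_bool_def)

lemma sum_of_bool_eq_0:
  fixes A b :: nat
  shows "(\<Sum>u\<le>A. of_bool (u = 0)) = (1 :: real)"
    and "0 < b \<Longrightarrow> (\<Sum>v<b. of_bool (v = 0)) = (1 :: real)"
proof -
  have *: "(\<Sum>u\<le>A. of_bool (u = 0)) = (1 :: real)" for A :: nat by (induction A) simp_all
  show "(\<Sum>u\<le>A. of_bool (u = 0)) = (1 :: real)" by (rule *)
  from *[of "b - 1"] show "0 < b \<Longrightarrow> (\<Sum>v<b. of_bool (v = 0)) = (1 :: real)"
    by (cases b) (simp_all add: lessThan_Suc_atMost)
qed

lemma sum_of_bool_pos: "(\<Sum>u\<le>A. of_bool (0 < u)) = real A"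
    "0 < b \<Longrightarrow> (\<Sum>v<b. of_bool (0 < v)) = real b - 1"
proof -
  have *: "(\<Sum>u\<le>A. of_bool (0 < u)) = real A" for A :: nat by (induction A) simp_all
  show "(\<Sum>u\<le>A. of_bool (0 < u)) = real A" by (rule *)
  from *[of "b - 1"] show "0 < b \<Longrightarrow> (\<Sum>v<b. of_bool (0 < v)) = real b - 1"
    by (cases b) (simp_all add: lessThan_Suc_atMost)
qed

lemma sum_distance_to_top: "(\<Sum>u\<le>A. real (A - u)) = real A * real (Suc A) / 2"
    "0 < b \<Longrightarrow> (\<Sum>v<b. real (b - 1 - v)) = (real b - 1) * real b / 2"
proof -
  have gauss: "(\<Sum>u\<le>A. real u) = real A * real (Suc A) / 2" for A
    by (induction A) (simp_all add: field_simps)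
  have *: "(\<Sum>u\<le>A. real (A - u)) = real A * real (Suc A) / 2" for A
    using sum.nat_diff_reindex[of real "Suc A"] gauss[of A] by (simp add: lessThan_Suc_atMost)
  show "(\<Sum>u\<le>A. real (A - u)) = real A * real (Suc A) / 2" by (rule *)
  show "0 < b \<Longrightarrow> (\<Sum>v<b. real (b - 1 - v)) = (real b - 1) * real b / 2"
    using *[of "b - 1"] by (cases b) (simp_all add: lessThan_Suc_atMost)
qed

definition grid_point :: "nat \<Rightarrow> nat \<Rightarrow> nat \<Rightarrow> nat \<Rightarrow> nat \<Rightarrow> bool" where
  "grid_point A b k u w \<longleftrightarrow> u \<le> A \<and> w \<le> b \<and> (w = k \<longrightarrow> u = 0)"

text \<open>The increasing enumeration of the values of \<open>w\<close> other than
  \<open>k\<close>.\<close>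

definition bump :: "nat \<Rightarrow> nat \<Rightarrow> nat" where
  "bump k v = (if v < k then v else Suc v)"

lemma grid_point_bump: "u \<le> A \<Longrightarrow> v < b \<Longrightarrow> grid_point A b k u (bump k v)"
  by (auto simp: grid_point_def bump_def)

lemma grid_point_cases:
  assumes "grid_point A b k u w" "k < b"
  obtains (special) "u = 0" "w = k" | (bump) v where "v < b" "w = bump k v"
proof (cases w k rule: linorder_cases)
  case less
  with assms bump[of w] show ?thesis by (simp add: bump_def)
next
  case equal
  with assms special show ?thesis by (simp add: grid_point_def)
next
  case greater
  with assms bump[of "w - 1"] show ?thesis by (auto simp: bump_def grid_point_def)
qed

text \<open>All that the rowmotion argument uses of the lattice. The order is reversed, so
  \<open>pt 0 0\<close> is the top element and going down increases coordinates.\<close>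

locale hook_grid =
  fixes L :: "('a, 'm) gorder_scheme" and pt :: "nat \<Rightarrow> nat \<Rightarrow> 'a" and A b k :: nat
  assumes k_less: "k < b"
    and carrier_eq: "carrier L = {pt u w |u w. grid_point A b k u w}"
    and eq_eq: "(.=\<^bsub>L\<^esub>) = (=)"
    and le_iff: "\<lbrakk>grid_point A b k u w; grid_point A b k u' w'\<rbrakk> \<Longrightarrow>
      pt u w \<sqsubseteq>\<^bsub>L\<^esub> pt u' w' \<longleftrightarrow> u' \<le> u \<and> w' \<le> w"
begin

abbreviation "grid \<equiv> grid_point A b k"

lemma pt_inject: "grid u w \<Longrightarrow> grid u' w' \<Longrightarrow> pt u w = pt u' w' \<longleftrightarrow> u = u' \<and> w = w'"
  by (metis le_iff order_antisym order_refl)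

lemma pt_carrier: "grid u w \<Longrightarrow> pt u w \<in> carrier L"
  by (auto simp: carrier_eq)

lemma carrierE:
  assumes "x \<in> carrier L" obtains u w where "grid u w" "x = pt u w"
  using assms by (auto simp: carrier_eq)

lemma bex_carrier: "(\<exists>x\<in>carrier L. P x) \<longleftrightarrow> (\<exists>u w. grid u w \<and> P (pt u w))"
  by (auto simp: carrier_eq)

lemma less_iff: "grid u w \<Longrightarrow> grid u' w' \<Longrightarrow>
    pt u w \<sqsubset>\<^bsub>L\<^esub> pt u' w' \<longleftrightarrow> u' \<le> u \<and> w' \<le> w \<and> (u', w') \<noteq> (u, w)"
  by (auto simp: lless_def le_iff eq_eq pt_inject)

text \<open>The library meet is a chosen greatest lower bound. Antisymmetry in coordinates makes the
  choice unique, so meets can be computed componentwise.\<close>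

lemma inf_eqI:
  assumes "S \<subseteq> carrier L" "grid u w"
    and "\<And>s. s \<in> S \<Longrightarrow> pt u w \<sqsubseteq>\<^bsub>L\<^esub> s"
    and "\<And>u' w'. \<lbrakk>grid u' w'; \<And>s. s \<in> S \<Longrightarrow> pt u' w' \<sqsubseteq>\<^bsub>L\<^esub> s\<rbrakk> \<Longrightarrow> u \<le> u' \<and> w \<le> w'"
  shows "\<Sqinter>\<^bsub>L\<^esub> S = pt u w"
  unfolding inf_def
proof (rule some_equality)
  have *: "pt u w \<in> Lower L S"
    using assms by (auto simp: Lower_def pt_carrier)
  show "greatest L (pt u w) (Lower L S)"
    unfolding greatest_def
  proof (intro conjI ballI *)
    fix x assume "x \<in> Lower L S"
    then have "x \<in> carrier L" and xs: "\<And>s. s \<in> S \<Longrightarrow> x \<sqsubseteq>\<^bsub>L\<^esub> s"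
      using assms(1) by (auto simp: Lower_def)
    then obtain u' w' where "grid u' w'" "x = pt u' w'" by (metis carrierE)
    with xs show "x \<sqsubseteq>\<^bsub>L\<^esub> pt u w" using assms(2,4) by (simp add: le_iff)
  qed (auto simp: Lower_def)
  fix x assume x: "greatest L x (Lower L S)"
  then have "x \<in> Lower L S" by (simp add: greatest_def)
  then have "x \<in> carrier L" and xs: "\<And>s. s \<in> S \<Longrightarrow> x \<sqsubseteq>\<^bsub>L\<^esub> s"
    using assms(1) by (auto simp: Lower_def)
  then obtain u' w' where x': "grid u' w'" "x = pt u' w'" by (metis carrierE)
  with xs have "u \<le> u' \<and> w \<le> w'" using assms(4) by simp
  moreover have "pt u w \<sqsubseteq>\<^bsub>L\<^esub> x" using x * by (simp add: greatest_def)
  ultimately show "x = pt u w" using x' assms(2) by (simp add: le_iff pt_inject)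
qed

text \<open>
  The coordinates reverse the order, so meets are componentwise maxima, moved on to the next grid
  point if they hit one of the missing points \<open>(u, k)\<close>.
\<close>

definition clear :: "nat \<Rightarrow> nat \<Rightarrow> nat" where
  "clear u w = (if 0 < u \<and> w = k then Suc w else w)"

lemma grid_clear: "u \<le> A \<Longrightarrow> w \<le> b \<Longrightarrow> grid u (clear u w)"
  using k_less by (auto simp: grid_point_def clear_def)

lemma clear_grid: "grid u w \<Longrightarrow> clear u w = w"
  by (auto simp: clear_def grid_point_def)

lemma meet_pt:
  assumes "grid u w" "grid u' w'"
  shows "pt u w \<sqinter>\<^bsub>L\<^esub> pt u' w' = pt (max u u') (clear (max u u') (max w w'))"
proof -
  let ?u = "max u u'" and ?w = "clear (max u u') (max w w')"
  have g: "grid ?u ?w"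
    using assms by (intro grid_clear) (auto simp: grid_point_def)
  have ub: "w \<le> ?w" "w' \<le> ?w" by (auto simp: clear_def)
  show ?thesis
    unfolding meet_def
  proof (rule inf_eqI[OF _ g])
    show "{pt u w, pt u' w'} \<subseteq> carrier L" using assms by (simp add: pt_carrier)
    fix s assume "s \<in> {pt u w, pt u' w'}"
    then show "pt ?u ?w \<sqsubseteq>\<^bsub>L\<^esub> s" using assms g ub by (elim insertE) (simp_all add: le_iff)
  next
    fix x y assume xy: "grid x y" and lb: "\<And>s. s \<in> {pt u w, pt u' w'} \<Longrightarrow> pt x y \<sqsubseteq>\<^bsub>L\<^esub> s"
    have "u \<le> x \<and> w \<le> y" "u' \<le> x \<and> w' \<le> y"
      using lb[of "pt u w"] lb[of "pt u' w'"] xy assms by (simp_all add: le_iff)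
    \<comment> \<open>A lower bound with positive first coordinate avoids \<open>k\<close> in the
      second, which justifies the extra step made by \<open>clear\<close>.\<close>
    moreover have "y = k \<longrightarrow> x = 0" using xy by (simp add: grid_point_def)
    ultimately show "?u \<le> x \<and> ?w \<le> y" by (auto simp: clear_def le_less)
  qed
qed

section \<open>Covers, pop and rowmotion in coordinates\<close>

lemma covered_by_pt_iff:
  assumes g: "grid u w"
  shows "covered_by L y (pt u w) \<longleftrightarrow>
    u < A \<and> w \<noteq> k \<and> y = pt (Suc u) w \<or> w < b \<and> y = pt u (clear u (Suc w))"
proof
  assume "covered_by L y (pt u w)"
  then obtain u' w' where y: "grid u' w'" "y = pt u' w'" "y \<sqsubset>\<^bsub>L\<^esub> pt u w"
    and no: "\<And>x v. grid x v \<Longrightarrow> \<not> (y \<sqsubset>\<^bsub>L\<^esub> pt x v \<and> pt x v \<sqsubset>\<^bsub>L\<^esub> pt u w)"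
    unfolding covered_by_def using pt_carrier by (metis carrierE)
  have no': "u' = x \<and> w' = v" if "grid x v" "x \<le> u'" "v \<le> w'" "u \<le> x" "w \<le> v" "(x, v) \<noteq> (u, w)" for x v
    using no[OF that(1)] that y g by (auto simp: less_iff)
  have ww: "u \<le> u'" "w \<le> w'" "(u, w) \<noteq> (u', w')" using y g by (auto simp: less_iff)
  show "u < A \<and> w \<noteq> k \<and> y = pt (Suc u) w \<or> w < b \<and> y = pt u (clear u (Suc w))"
  proof (cases "u < u' \<and> w \<noteq> k")
    case True
    then have "grid (Suc u) w" using g y by (auto simp: grid_point_def)
    then show ?thesis using no'[of "Suc u" w] True ww y g by (auto simp: grid_point_def)
  next
    case False
    \<comment> \<open>If \<open>u < u'\<close> and \<open>w = k\<close>, then \<open>u'\<close> is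
      positive, so \<open>w'\<close> cannot be \<open>k\<close> and must exceed it.\<close>
    then have "w < w'" using ww y g by (auto simp: grid_point_def order_le_less)
    then have "w < b" using y by (auto simp: grid_point_def)
    moreover have "grid u (clear u (Suc w))" using g \<open>w < b\<close> by (intro grid_clear) (auto simp: grid_point_def)
    moreover have "clear u (Suc w) \<le> w'"
      using \<open>w < w'\<close> ww y by (auto simp: clear_def grid_point_def order_le_less)
    ultimately show ?thesis
      using no'[of u "clear u (Suc w)"] ww y by (auto simp: clear_def split: if_splits)
  qed
next
  assume "u < A \<and> w \<noteq> k \<and> y = pt (Suc u) w \<or> w < b \<and> y = pt u (clear u (Suc w))"
  then show "covered_by L y (pt u w)"
  proof (elim disjE conjE)
    assume *: "u < A" "w \<noteq> k" "y = pt (Suc u) w"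
    then have up: "grid (Suc u) w" using g by (auto simp: grid_point_def)
    have "\<not> (pt (Suc u) w \<sqsubset>\<^bsub>L\<^esub> pt x v \<and> pt x v \<sqsubset>\<^bsub>L\<^esub> pt u w)" if "grid x v" for x v
      using that g up by (auto simp: less_iff)
    then show ?thesis using g up *(3)
      by (auto simp: covered_by_def bex_carrier pt_carrier less_iff)
  next
    assume *: "w < b" "y = pt u (clear u (Suc w))"
    then have right: "grid u (clear u (Suc w))"
      using g by (intro grid_clear) (auto simp: grid_point_def)
    have min: "clear u (Suc w) \<le> v" if "grid u v" "w \<le> v" "w \<noteq> v" for v
      using that by (auto simp: clear_def grid_point_def le_less)
    have "\<not> (pt u (clear u (Suc w)) \<sqsubset>\<^bsub>L\<^esub> pt x v \<and> pt x v \<sqsubset>\<^bsub>L\<^esub> pt u w)" if "grid x v" for x v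
      using that g right min[of v] by (auto simp: less_iff)
    moreover have "pt u (clear u (Suc w)) \<sqsubset>\<^bsub>L\<^esub> pt u w"
      using g right by (auto simp: less_iff clear_def)
    ultimately show ?thesis using g right *(2)
      by (simp add: covered_by_def bex_carrier pt_carrier)
  qed
qed

lemma ddeg_pt:
  assumes g: "grid u w"
  shows "ddeg L (pt u w) = of_bool (u < A \<and> w \<noteq> k) + of_bool (w < b)"
proof -
  have "{y. covered_by L y (pt u w)} =
      (if u < A \<and> w \<noteq> k then {pt (Suc u) w} else {}) \<union> (if w < b then {pt u (clear u (Suc w))} else {})"
    using g by (auto simp: covered_by_pt_iff)
  moreover have "pt (Suc u) w \<noteq> pt u (clear u (Suc w))" if "u < A" "w \<noteq> k" "w < b"
    using that grid_clear[of u "Suc w"] by (subst pt_inject) (auto simp: grid_point_def)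
  ultimately show ?thesis by (cases "u < A \<and> w \<noteq> k \<and> w < b") (auto simp: ddeg_def)
qed

text \<open>\<open>pop_u\<close> and \<open>pop_w\<close> are the coordinates of
  \<open>pop_down\<close>: one step in each direction that has a cover. The second is cleared
  relative to the new first coordinate, because the two covers may exist while their componentwise
  maximum is missing. For example, \<open>(1, k - 1)\<close> and \<open>(0, k)\<close> are grid
  points with meet \<open>(1, k + 1)\<close> when \<open>0 < A\<close> and
  \<open>0 < k\<close>.\<close>

definition pop_u :: "nat \<Rightarrow> nat \<Rightarrow> nat" where
  "pop_u u w = (if u < A \<and> w \<noteq> k then Suc u else u)"

definition pop_w :: "nat \<Rightarrow> nat \<Rightarrow> nat" where
  "pop_w u w = (if w < b then clear (pop_u u w) (Suc w) else w)"

lemma grid_pop: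
  assumes g: "grid u w"
  shows "grid (pop_u u w) (pop_w u w)"
proof (cases "w < b")
  case True
  then have "pop_w u w = clear (pop_u u w) (Suc w)" by (simp add: pop_w_def)
  moreover have "pop_u u w \<le> A" using g by (auto simp: pop_u_def grid_point_def)
  ultimately show ?thesis using True by (simp add: grid_clear)
next
  case False
  then show ?thesis using g k_less by (auto simp: pop_u_def pop_w_def grid_point_def)
qed

lemma pop_down_pt:
  assumes g: "grid u w"
  shows "pop_down L (pt u w) = pt (pop_u u w) (pop_w u w)"
proof -
  let ?C = "{y. covered_by L y (pt u w)}"
  have C: "?C \<subseteq> carrier L" by (auto simp: covered_by_def)
  have up: "grid (Suc u) w" if "u < A" "w \<noteq> k" using g that by (auto simp: grid_point_def)
  have right: "grid u (clear u (Suc w))" if "w < b"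
    using g that by (intro grid_clear) (auto simp: grid_point_def)
  have pop: "grid (pop_u u w) (pop_w u w)" using g by (rule grid_pop)
  show ?thesis
  proof (cases "?C = {}")
    case True
    \<comment> \<open>With no element covered, the inner meet is that of the empty set, namely the
      top element \<open>pt 0 0\<close>, and the outer meet returns \<open>pt u w\<close>.\<close>
    have 00: "grid 0 0" by (simp add: grid_point_def)
    have "\<Sqinter>\<^bsub>L\<^esub> ?C = pt 0 0" unfolding True by (rule inf_eqI) (use 00 in auto)
    moreover have "\<not> (u < A \<and> w \<noteq> k)" "\<not> w < b" using True g by (auto simp: covered_by_pt_iff)
    ultimately show ?thesis using g 00
      by (auto simp: pop_down_def meet_pt pop_u_def pop_w_def clear_def grid_point_def)
  next
    case False
    have "\<Sqinter>\<^bsub>L\<^esub> ?C = pt (pop_u u w) (pop_w u w)"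
    proof (rule inf_eqI[OF C pop])
      fix s assume "s \<in> ?C"
      then show "pt (pop_u u w) (pop_w u w) \<sqsubseteq>\<^bsub>L\<^esub> s"
        using g pop up right by (auto simp: covered_by_pt_iff le_iff) (auto simp: pop_u_def pop_w_def clear_def)
    next
      fix u' w' assume *: "grid u' w'" and lb: "\<And>s. s \<in> ?C \<Longrightarrow> pt u' w' \<sqsubseteq>\<^bsub>L\<^esub> s"
      have 1: "u < A \<Longrightarrow> w \<noteq> k \<Longrightarrow> Suc u \<le> u' \<and> w \<le> w'"
        using lb[of "pt (Suc u) w"] g up * by (simp add: covered_by_pt_iff le_iff)
      have 2: "w < b \<Longrightarrow> u \<le> u' \<and> clear u (Suc w) \<le> w'"
        using lb[of "pt u (clear u (Suc w))"] g right * by (simp add: covered_by_pt_iff le_iff)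
      have "u < A \<and> w \<noteq> k \<or> w < b" using False g by (auto simp: covered_by_pt_iff)
      then have u': "pop_u u w \<le> u'" using 1 2 by (cases "u < A \<and> w \<noteq> k") (auto simp: pop_u_def)
      have "pop_w u w \<le> w'"
      proof (cases "w < b")
        case True
        have "Suc w \<le> clear u (Suc w)" by (simp add: clear_def)
        then have "Suc w \<le> w'" using 2 True by linarith
        \<comment> \<open>A lower bound at \<open>w' = k\<close> forces the new first coordinate to
          be 0, and then \<open>clear\<close> does not move.\<close>
        moreover have "w' = k \<Longrightarrow> pop_u u w = 0" using u' * by (simp add: grid_point_def)
        ultimately show ?thesis using True by (cases "w' = k") (auto simp: pop_w_def clear_def)
      next
        case False
        then show ?thesis using 1 \<open>u < A \<and> w \<noteq> k \<or> w < b\<close> by (simp add: pop_w_def)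
      qed
      with u' show "pop_u u w \<le> u' \<and> pop_w u w \<le> w'" ..
    qed
    \<comment> \<open>The meet of the covered elements already lies below \<open>pt u w\<close>, so
      the outer meet changes nothing.\<close>
    moreover have "max u (pop_u u w) = pop_u u w" by (simp add: pop_u_def)
    moreover have "max w (pop_w u w) = pop_w u w" by (simp add: pop_w_def clear_def)
    ultimately show ?thesis using g pop by (simp add: pop_down_def meet_pt clear_grid)
  qed
qed

text \<open>A greatest candidate is the only maximal one. It therefore suffices to find the
  candidate with componentwise least coordinates, and no general theory of semidistributivity
  enters.\<close>

lemma rowmotion_pt_eqI:
  assumes g: "grid u w" and r: "grid u' w'"
    and meet: "pt u w \<sqinter>\<^bsub>L\<^esub> pt u' w' = pop_down L (pt u w)"
    and max: "\<And>x y. grid x y \<Longrightarrow> pt u w \<sqinter>\<^bsub>L\<^esub> pt x y = pop_down L (pt u w) \<Longrightarrow> u' \<le> x \<and> w' \<le> y"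
  shows "rowmotion L (pt u w) = pt u' w'"
  unfolding rowmotion_def
proof (rule the_equality)
  let ?S = "{y \<in> carrier L. pt u w \<sqinter>\<^bsub>L\<^esub> y = pop_down L (pt u w)}"
  have below: "s \<sqsubseteq>\<^bsub>L\<^esub> pt u' w'" if "s \<in> ?S" for s
    using that max r unfolding carrier_eq by (auto simp: le_iff)
  have "\<not> pt u' w' \<sqsubset>\<^bsub>L\<^esub> s" if "s \<in> ?S" for s
    using that below[OF that] r unfolding carrier_eq by (auto simp: le_iff less_iff)
  with r meet show "is_maximal L ?S (pt u' w')"
    by (auto simp: is_maximal_def pt_carrier)
  fix m assume m: "is_maximal L ?S m"
  then have "m \<in> ?S" by (simp add: is_maximal_def)
  then have "m \<sqsubseteq>\<^bsub>L\<^esub> pt u' w'" by (rule below)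
  moreover have "\<not> m \<sqsubset>\<^bsub>L\<^esub> pt u' w'"
    using m r meet by (simp add: is_maximal_def pt_carrier)
  ultimately show "m = pt u' w'" by (auto simp: lless_def eq_eq)
qed

text \<open>From \<open>(0, k)\<close> only the second coordinate can grow. The result
  \<open>(0, Suc k)\<close> has \<open>v = k\<close>, so it is the torus point
  \<open>(0, k)\<close>.\<close>

lemma rowmotion_special: "rowmotion L (pt 0 k) = pt 0 (Suc k)"
proof -
  have g: "grid 0 k" "grid 0 (Suc k)" using k_less by (auto simp: grid_point_def)
  have pop: "pop_down L (pt 0 k) = pt 0 (Suc k)"
    using g k_less by (simp add: pop_down_pt pop_u_def pop_w_def clear_def)
  show ?thesis
  proof (rule rowmotion_pt_eqI[OF g])
    show "pt 0 k \<sqinter>\<^bsub>L\<^esub> pt 0 (Suc k) = pop_down L (pt 0 k)"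
      using g by (simp add: pop meet_pt clear_def)
    fix x y assume xy: "grid x y" "pt 0 k \<sqinter>\<^bsub>L\<^esub> pt x y = pop_down L (pt 0 k)"
    have "grid x (clear x (max k y))"
      using xy k_less by (intro grid_clear) (auto simp: grid_point_def)
    with xy show "0 \<le> x \<and> Suc k \<le> y"
      using g by (auto simp: pop meet_pt pt_inject clear_def max_def split: if_splits)
  qed
qed

text \<open>Meeting with the image must raise exactly those coordinates that \<open>pop_down\<close>
  raises; the least way is to use the raised value there and 0, or the least permitted value,
  elsewhere. For \<open>u = A\<close> the new first coordinate is 0, where \<open>w = k\<close> is
  allowed, so \<open>bump\<close> is replaced by the plain successor or 0. This is where the
  additional element is hit.\<close>

lemma rowmotion_bump:
  assumes u: "u \<le> A" and v: "v < b"
    and r: "grid u' w'"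
      "u' = (if u < A then Suc u else 0)"
      "w' = (if Suc v < b then if u < A then bump k (Suc v) else Suc (bump k v)
             else if u < A then bump k 0 else 0)"
  shows "rowmotion L (pt u (bump k v)) = pt u' w'"
proof -
  let ?w = "bump k v"
  have g: "grid u ?w" using u v by (rule grid_point_bump)
  have wk: "?w \<noteq> k" by (simp add: bump_def)
  have wb: "?w < b \<longleftrightarrow> Suc v < b" using v k_less by (auto simp: bump_def)
  have pop: "pop_down L (pt u ?w) = pt (pop_u u ?w) (pop_w u ?w)" using g by (rule pop_down_pt)
  have gp: "grid (pop_u u ?w) (pop_w u ?w)" using g by (rule grid_pop)
  have pu: "pop_u u ?w = (if u < A then Suc u else u)" by (simp add: pop_u_def wk)
  have pw: "pop_w u ?w = (if Suc v < b then clear (pop_u u ?w) (Suc ?w) else ?w)"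
    by (simp add: pop_w_def wb)
  have bump_Suc: "bump k (Suc v) = (if Suc ?w = k then Suc k else Suc ?w)"
    by (auto simp: bump_def)
  have u0: "u = A \<Longrightarrow> u' = 0" "u < A \<Longrightarrow> u' = Suc u" using r(2) by auto
  show ?thesis
  proof (rule rowmotion_pt_eqI[OF g r(1)])
    have "max u u' = pop_u u ?w" using u0 u by (auto simp: pu)
    moreover have "clear (pop_u u ?w) (max ?w w') = pop_w u ?w"
    proof (cases "Suc v < b")
      case True
      then have "max ?w w' = (if u < A then bump k (Suc v) else Suc ?w)"
        using r(3) by (auto simp: bump_Suc)
      then show ?thesis using True by (auto simp: pw pu clear_def bump_Suc)
    next
      case False
      then have "w' \<le> ?w" using r(3) v k_less by (auto simp: bump_def)
      then show ?thesis using False wk by (simp add: pw clear_def max_def)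
    qed
    ultimately show "pt u ?w \<sqinter>\<^bsub>L\<^esub> pt u' w' = pop_down L (pt u ?w)"
      using g r(1) by (simp add: pop meet_pt)
    fix x y assume xy: "grid x y" "pt u ?w \<sqinter>\<^bsub>L\<^esub> pt x y = pop_down L (pt u ?w)"
    have "grid (max u x) (clear (max u x) (max ?w y))"
      using xy g by (intro grid_clear) (auto simp: grid_point_def)
    then have *: "max u x = pop_u u ?w" "clear (max u x) (max ?w y) = pop_w u ?w"
      using xy(2) pt_inject[OF _ gp] unfolding pop meet_pt[OF g xy(1)] by blast+
    have x: "u' \<le> x" using *(1) u0 u by (cases "u = A") (auto simp: pu max_def split: if_splits)
    have yk: "y = k \<Longrightarrow> x = 0" using xy(1) by (simp add: grid_point_def)
    \<comment> \<open>As \<open>?w\<close> is not \<open>k\<close>, \<open>clear\<close> alone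
      cannot raise it, so the increase must come from \<open>y\<close>.\<close>
    have y: "Suc ?w \<le> y" if "Suc v < b"
    proof -
      have "Suc ?w \<le> clear (max u x) (max ?w y)" using *(2) that by (simp add: pw clear_def)
      then show ?thesis using wk by (auto simp: clear_def max_def split: if_splits)
    qed
    \<comment> \<open>When \<open>u < A\<close>, the first coordinate \<open>x\<close> is at least
      \<open>Suc u\<close>, so \<open>y\<close> cannot be \<open>k\<close>; this allows the target
      to skip \<open>k\<close>.\<close>
    have "w' \<le> y"
    proof (cases "Suc v < b"; cases "u < A")
      assume "Suc v < b" "u < A"
      then show ?thesis using y yk x u0 r(3) by (cases "y = k") (auto simp: bump_Suc)
    next
      assume "\<not> Suc v < b" "u < A"
      then show ?thesis using yk x u0 r(3) by (cases "y = k") (auto simp: bump_def)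
    qed (use y r(3) in auto)
    with x show "u' \<le> x \<and> w' \<le> y" ..
  qed
qed

definition cell :: "nat \<times> nat \<Rightarrow> 'a" where
  "cell = (\<lambda>(u, v). pt u (bump k v))"

lemma carrier_cells: "carrier L = insert (pt 0 k) (cell ` ({..<Suc A} \<times> {..<b}))" (is "_ = ?C")
proof
  have "pt u w \<in> ?C" if g: "grid u w" for u w
    using g k_less
  proof (cases rule: grid_point_cases)
    case (bump v)
    then show ?thesis using g by (auto simp: cell_def grid_point_def intro!: image_eqI[of _ _ "(u, v)"])
  qed simp
  then show "carrier L \<subseteq> ?C" by (metis carrierE subsetI)
  have "grid 0 k" using k_less by (simp add: grid_point_def)
  then show "?C \<subseteq> carrier L" by (auto simp: cell_def intro!: pt_carrier grid_point_bump)
qed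

text \<open>The resets to 0 in \<open>rowmotion_bump\<close> are reductions modulo
  \<open>Suc A\<close> and \<open>b\<close>. Its value is the additional element exactly when the
  translated point is \<open>(0, k)\<close>, that is, for \<open>u = A\<close> and
  \<open>v = k - 1\<close>, or \<open>v = b - 1\<close> if \<open>k = 0\<close>.\<close>

sublocale torus_insertion "Suc A" b k cell "pt 0 k" "rowmotion L"
proof
  have 0: "grid 0 k" using k_less by (simp add: grid_point_def)
  have bump_inj: "bump k v = bump k v' \<longleftrightarrow> v = v'" for v v' by (auto simp: bump_def)
  have bump_neq: "bump k v \<noteq> k" for v by (simp add: bump_def)
  show "inj_on cell ({..<Suc A} \<times> {..<b})"
    by (rule inj_onI) (auto simp: cell_def pt_inject grid_point_bump bump_inj less_Suc_eq_le)
  show "pt 0 k \<notin> cell ` ({..<Suc A} \<times> {..<b})"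
    using 0 by (auto simp: cell_def pt_inject grid_point_bump bump_neq[symmetric] less_Suc_eq_le)
  show "rowmotion L (pt 0 k) = cell (0, k)"
    by (simp add: rowmotion_special cell_def bump_def)
  fix z assume "z \<in> {..<Suc A} \<times> {..<b}"
  then obtain u v where z: "z = (u, v)" "u \<le> A" "v < b" by auto
  let ?u = "if u < A then Suc u else 0"
  let ?w = "if Suc v < b then if u < A then bump k (Suc v) else Suc (bump k v)
             else if u < A then bump k 0 else 0"
  have "grid ?u ?w"
    using z k_less by (auto simp: bump_def grid_point_def)
  then have "rowmotion L (cell z) = pt ?u ?w"
    using z by (simp add: cell_def rowmotion_bump)
  moreover have "Suc u mod Suc A = ?u" "Suc v mod b = (if Suc v < b then Suc v else 0)"
    using z by (auto simp: mod_Suc)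
  ultimately show "rowmotion L (cell z) =
      (if torus_step (Suc A) b z = (0, k) then pt 0 k else cell (torus_step (Suc A) b z))"
    using z by (auto simp: torus_step_def cell_def bump_def)
qed (use k_less in auto)

lemma row_orbits_eq: "row_orbits L = orbit (rowmotion L) ` C"
  by (simp add: row_orbits_def carrier_cells)

text \<open>Membership of the additional element is replaced by the size of the orbit, which is how
  the final formulas distinguish orbits.\<close>

lemma sum_row_orbit:
  fixes f :: "'a \<Rightarrow> nat"
  assumes f: "\<And>u v. u \<le> A \<Longrightarrow> v < b \<Longrightarrow>
      real (f (pt u (bump k v))) = F u + G v + (if u = 0 \<and> v = k then c else 0)"
    and Q: "Q \<in> row_orbits L"
  shows "real (\<Sum>z\<in>Q. f z) =
    (real b * (\<Sum>u\<le>A. F u) + real (Suc A) * (\<Sum>v<b. G v)) / real (gcd (Suc A) b)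
    + (if card Q = lcm (Suc A) b then 0 else c + real (f (pt 0 k)))"
proof -
  have Q': "Q \<in> orbit (rowmotion L) ` C" using Q by (simp add: row_orbits_eq)
  have "(\<Sum>z\<in>Q. real (f z)) = real (lcm (Suc A) b) / real (Suc A) * (\<Sum>n<Suc A. F n) +
      real (lcm (Suc A) b) / real b * (\<Sum>n<b. G n) + (if pt 0 k \<in> Q then c + real (f (pt 0 k)) else 0)"
    by (rule sum_orbit_R[OF _ Q']) (simp add: cell_def f)
  also have "\<dots> = (real b * (\<Sum>u\<le>A. F u) + real (Suc A) * (\<Sum>v<b. G v)) / real (gcd (Suc A) b) +
      (if pt 0 k \<in> Q then c + real (f (pt 0 k)) else 0)"
    using real_lcm_div[of "Suc A" b] k_less
    by (simp only: lessThan_Suc_atMost add_divide_distrib times_divide_eq_left zero_less_Suc gr_implies_not0 neq0_conv)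
  also have "pt 0 k \<in> Q \<longleftrightarrow> \<not> card Q = lcm (Suc A) b" using card_orbit_R[OF Q'] by simp
  finally show ?thesis by (simp only: of_nat_sum if_not_P if_P split: if_split) simp
qed

lemma sum_ddeg:
  assumes "Q \<in> row_orbits L"
  shows "real (\<Sum>z\<in>Q. ddeg L z) =
    (real b * real A + real (Suc A) * (real b - 1)) / real (gcd (Suc A) b)
    + (if card Q = lcm (Suc A) b then 0 else 1)"
proof -
  have "real (ddeg L (pt u (bump k v))) = of_bool (u < A) + of_bool (v < b - 1) +
      (if u = 0 \<and> v = k then 0 else 0)" if "u \<le> A" "v < b" for u v
  proof -
    have "bump k v \<noteq> k" "bump k v < b \<longleftrightarrow> v < b - 1" using k_less that by (auto simp: bump_def)
    then show ?thesis using that by (simp add: ddeg_pt grid_point_bump)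
  qed
  note sum = sum_row_orbit[OF this assms]
  have "real (ddeg L (pt 0 k)) = 1" using k_less by (simp add: ddeg_pt grid_point_def)
  with sum show ?thesis
    using sum_of_bool_less_top[of A] sum_of_bool_less_pred[of b] k_less by simp
qed

lemma row_orbit_sizes:
  shows "Q \<in> row_orbits L \<Longrightarrow> card Q = lcm (Suc A) b \<or> card Q = lcm (Suc A) b + 1"
    and "card {Q \<in> row_orbits L. card Q = lcm (Suc A) b} = gcd (Suc A) b - 1"
    and "card {Q \<in> row_orbits L. card Q = lcm (Suc A) b + 1} = 1"
  unfolding row_orbits_eq by (fact orbit_size_counts)+

end

section \<open>Paths above the hook\<close>

lemma card_Collect_nat_Suc:
  assumes "finite {i. P (Suc i)}"
  shows "card {i. P i} = of_bool (P 0) + card {i. P (Suc i)}"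
proof -
  have "{i. P i} = (if P 0 then {0} else {}) \<union> Suc ` {i. P (Suc i)}"
    by (auto simp: image_iff) (metis not0_implies_Suc)+
  then show ?thesis using assms by (simp add: card_image card_insert_if)
qed

lemma height_Nil: "height [] x = 0"
  by (simp add: height_def)

lemma height_N: "height (N # p) x = Suc (height p x)"
  unfolding height_def by (subst card_Collect_nat_Suc) simp_all

lemma height_E: "height (E # p) x = (if x = 0 then 0 else height p (x - 1))"
proof -
  have "height (E # p) x = card {i. i < length p \<and> p ! i = N \<and> Suc (count_list (take i p) E) \<le> x}"
    unfolding height_def by (subst card_Collect_nat_Suc) simp_all
  then show ?thesis by (cases x) (simp_all add: height_def)
qed

lemma height_replicate_N: "height (replicate n N @ p) x = n + height p x"
  by (induction n) (simp_all add: height_N)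

lemma height_replicate_E: "height (replicate n E @ p) x = (if x < n then 0 else height p (x - n))"
  by (induction n arbitrary: x) (auto simp: height_E)

lemma height_only_E: "height (replicate n E) x = 0"
  using height_replicate_E[of n "[]" x] by (simp add: height_Nil)

lemmas height_simps = height_Nil height_N height_E height_replicate_N height_replicate_E height_only_E

lemma peak_Nil: "peak [] = 0" and peak_single: "peak [x] = 0"
  by (simp_all add: peak_def)

lemma peak_Cons: "peak (x # y # p) = of_bool (x = N \<and> y = E) + peak (y # p)"
  unfolding peak_def by (subst card_Collect_nat_Suc) (simp_all add: conj_commute)

lemma val_Nil: "val [] = 0" and val_single: "val [x] = 0"
  by (simp_all add: val_def)

lemma val_Cons: "val (x # y # p) = of_bool (x = E \<and> y = N) + val (y # p)"
  unfolding val_def by (subst card_Collect_nat_Suc) (simp_all add: conj_commute)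

lemma peak_E: "peak (E # p) = peak p"
  by (cases p) (simp_all add: peak_Nil peak_single peak_Cons)

lemma peak_N: "peak (N # p) = of_bool (p \<noteq> [] \<and> hd p = E) + peak p"
  by (cases p) (simp_all add: peak_Nil peak_single peak_Cons)

lemma val_N: "val (N # p) = val p"
  by (cases p) (simp_all add: val_Nil val_single val_Cons)

lemma val_E: "val (E # p) = of_bool (p \<noteq> [] \<and> hd p = N) + val p"
  by (cases p) (simp_all add: val_Nil val_single val_Cons)

lemma peak_replicate_E: "peak (replicate n E @ p) = peak p"
  by (induction n) (simp_all add: peak_E)

lemma val_replicate_N: "val (replicate n N @ p) = val p"
  by (induction n) (simp_all add: val_N)

lemma hd_replicate_append: "hd (replicate n x @ p) = (if n = 0 then hd p else x)"
  by (cases n) simp_all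

lemma peak_replicate_N:
  "peak (replicate n N @ p) = of_bool (0 < n \<and> p \<noteq> [] \<and> hd p = E) + peak p"
  by (induction n) (auto simp: peak_N hd_replicate_append)

lemma val_replicate_E:
  "val (replicate n E @ p) = of_bool (0 < n \<and> p \<noteq> [] \<and> hd p = N) + val p"
  by (induction n) (auto simp: val_E hd_replicate_append)

lemma peak_only_E: "peak (replicate n E) = 0"
  using peak_replicate_E[of n "[]"] by (simp add: peak_Nil)

lemma val_only_E: "val (replicate n E) = 0"
  using val_replicate_E[of n "[]"] by (simp add: val_Nil)

lemmas path_stat_simps = peak_Nil peak_E peak_N peak_replicate_E peak_replicate_N peak_only_E
  val_Nil val_E val_N val_replicate_E val_replicate_N val_only_E hd_replicate_append

lemma area_eq_sum: "area \<nu> \<mu> = (\<Sum>x<count_list \<nu> E. height \<mu> x - height \<nu> x)"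
proof -
  have "{(x, y). x < count_list \<nu> E \<and> height \<nu> x \<le> y \<and> y < height \<mu> x} =
      Sigma {..<count_list \<nu> E} (\<lambda>x. {height \<nu> x..<height \<mu> x})"
    by auto
  then show ?thesis by (simp add: area_def)
qed

lemma count_list_replicate: "count_list (replicate n x) y = (if x = y then n else 0)"
  by (induction n) auto

section \<open>Normal forms of the paths above the hook\<close>

definition col :: "nat \<Rightarrow> nat \<Rightarrow> nat \<Rightarrow> path" where
  "col A b w = replicate A N @ replicate w E @ N # replicate (b - w) E"

definition arm :: "nat \<Rightarrow> nat \<Rightarrow> nat \<Rightarrow> nat \<Rightarrow> path" where
  "arm A b u v =
     replicate (A - u) N @ E # replicate u N @ replicate v E @ N # replicate (b - 1 - v) E"

text \<open>The inner conditional inverts \<open>bump k\<close>. Its value at \<open>w = k\<close>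
  with \<open>u > 0\<close> is arbitrary, since that is not a grid point.\<close>

definition hook_pt :: "nat \<Rightarrow> nat \<Rightarrow> nat \<Rightarrow> nat \<Rightarrow> nat \<Rightarrow> path" where
  "hook_pt A b k u w = (if u = 0 then col A b w else arm A b u (if w < k then w else w - 1))"

lemma hook_pt_bump: "0 < u \<Longrightarrow> hook_pt A b k u (bump k v) = arm A b u v"
  by (auto simp: hook_pt_def bump_def)

lemma hook_Suc: "0 < b \<Longrightarrow> hook (Suc A) b = E # replicate A N @ replicate (b - 1) E @ [N]"
  by (simp add: hook_def)

lemma height_hook:
  assumes "0 < b" "x < b"
  shows "height (hook (Suc A) b) x = (if x = 0 then 0 else A)"
  using assms by (auto simp: hook_Suc height_simps)

lemma count_hook: "0 < b \<Longrightarrow> count_list (hook (Suc A) b) E = b" "count_list (hook (Suc A) b) N = Suc A"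
  by (simp_all add: hook_def count_list_replicate)

lemma weakly_above_hook:
  assumes "0 < b"
  shows "weakly_above p (hook (Suc A) b) \<longleftrightarrow> (\<forall>x. 0 < x \<and> x < b \<longrightarrow> A \<le> height p x)"
  using assms by (auto simp: weakly_above_def count_hook height_hook)

lemma height_col: "x < b \<Longrightarrow> height (col A b w) x = A + of_bool (w \<le> x)"
  by (auto simp: col_def height_simps)

lemma height_arm: "u \<le> A \<Longrightarrow> x < b \<Longrightarrow>
    height (arm A b u v) x = (if x = 0 then A - u else A + of_bool (v < x))"
  by (auto simp: arm_def height_simps)

lemma col_in_nu_paths: "w \<le> b \<Longrightarrow> 0 < b \<Longrightarrow> col A b w \<in> nu_paths (hook (Suc A) b)"
  by (auto simp: nu_paths_def weakly_above_hook count_hook height_col)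
     (simp_all add: col_def count_list_replicate)

lemma arm_in_nu_paths: "u \<le> A \<Longrightarrow> v < b \<Longrightarrow> arm A b u v \<in> nu_paths (hook (Suc A) b)"
  by (auto simp: nu_paths_def weakly_above_hook count_hook height_arm)
     (simp_all add: arm_def count_list_replicate)

lemma replicate_if_count_list_0:
  "count_list p E = 0 \<Longrightarrow> p = replicate (count_list p N) N"
  "count_list p N = 0 \<Longrightarrow> p = replicate (count_list p E) E"
proof (induction p)
  case (Cons s p)
  { case 1 then show ?case using Cons by (cases s) auto }
  { case 2 then show ?case using Cons by (cases s) auto }
qed simp_all

lemma first_E:
  assumes "count_list p E \<noteq> 0"
  obtains n q where "p = replicate n N @ E # q"
proof -
  from assms have "E \<in> set p" by (simp add: count_list_0_iff)
  then obtain r q where p: "p = r @ E # q" "E \<notin> set r" by (auto dest: split_list_first)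
  then have "r = replicate (count_list r N) N"
    by (intro replicate_if_count_list_0) (simp add: count_list_0_iff)
  with p that show ?thesis by metis
qed

lemma last_N:
  assumes "count_list p N \<noteq> 0"
  obtains n q where "p = q @ N # replicate n E"
proof -
  from assms have "N \<in> set p" by (simp add: count_list_0_iff)
  then obtain r q where p: "p = q @ N # r" "N \<notin> set r" by (auto dest: split_list_last)
  then have "r = replicate (count_list r E) E"
    by (intro replicate_if_count_list_0) (simp add: count_list_0_iff)
  with p that show ?thesis by metis
qed

text \<open>Cut the path at its first east step and its last north step. The height condition at
  abscissa 1 forces the north steps between them to come before any further east step.\<close>

lemma nu_paths_hook_cases:
  assumes b: "0 < b" and p: "p \<in> nu_paths (hook (Suc A) b)"
  obtains (col) w where "w \<le> b" "p = col A b w"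
  | (arm) u v where "0 < u" "u \<le> A" "v < b" "p = arm A b u v"
proof -
  have cE: "count_list p E = b" and cN: "count_list p N = Suc A"
    and above: "\<And>x. 0 < x \<Longrightarrow> x < b \<Longrightarrow> A \<le> height p x"
    using p b by (auto simp: nu_paths_def count_hook weakly_above_hook)
  from cE b obtain i q where pq: "p = replicate i N @ E # q" using first_E[of p] by auto
  have qE: "count_list q E = b - 1" and qN: "i + count_list q N = Suc A"
    using cE cN by (simp_all add: pq count_list_replicate)
  show thesis
  proof (cases "count_list q N = 0")
    case True
    then have "q = replicate (b - 1) E" using replicate_if_count_list_0(2) qE by metis
    then have "p = col A b 0"
      using True qN b by (cases b) (simp_all add: pq col_def replicate_append_same[symmetric])
    then show thesis using col by blast
  next
    case False
    then obtain y r where qr: "q = r @ N # replicate y E" using last_N by blast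
    have rE: "count_list r E + y = b - 1" and rN: "i + count_list r N = A"
      using qE qN by (simp_all add: qr count_list_replicate)
    have r: "r = replicate (A - i) N @ replicate (count_list r E) E"
    proof (cases "count_list r E = 0")
      case True
      moreover have "count_list r N = A - i" using rN by simp
      ultimately show ?thesis using replicate_if_count_list_0(1)[of r] by simp
    next
      case False
      then obtain c s where rs: "r = replicate c N @ E # s" using first_E by blast
      \<comment> \<open>An east step in \<open>r\<close> makes \<open>b\<close> at least 2, so the
        condition applies at abscissa 1. Only \<open>i + c\<close> north steps have been made
        there.\<close>
      have "A \<le> height p 1" using above[of 1] rE False by simp
      then have "A \<le> i + c" by (simp add: pq qr rs height_simps)
      then have "count_list s N = 0" "c = A - i" using rN by (simp_all add: rs count_list_replicate)
      moreover from this have "s = replicate (count_list s E) E"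
        using replicate_if_count_list_0(2) by metis
      ultimately show ?thesis by (simp add: rs count_list_replicate)
    qed
    define v where "v = count_list r E"
    have y: "y = b - 1 - v" and v: "v < b" using rE b by (auto simp: v_def)
    have p: "p = replicate i N @ E # replicate (A - i) N @ replicate v E @ N # replicate y E"
      using r by (simp add: pq qr v_def)
    show thesis
    proof (cases "i = A")
      case True
      \<comment> \<open>No north step separates the first east step from the run of
        \<open>v\<close>, so the run has length \<open>Suc v\<close>.\<close>
      then have "p = col A b (Suc v)" by (simp add: p col_def y)
      with v show thesis using col[of "Suc v"] by simp
    next
      case False
      then have "p = arm A b (A - i) v" using rN by (simp add: p arm_def y)
      then show thesis using arm[of "A - i" v] False rN v by simp
    qed
  qed
qed

lemma hook_pt_in_nu_paths:
  assumes "grid_point A b k u w" "k < b"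
  shows "hook_pt A b k u w \<in> nu_paths (hook (Suc A) b)"
  using assms by (auto simp: hook_pt_def grid_point_def intro!: col_in_nu_paths arm_in_nu_paths)

lemma nu_paths_hook:
  assumes "k < b"
  shows "nu_paths (hook (Suc A) b) = {hook_pt A b k u w |u w. grid_point A b k u w}"
proof (intro equalityI subsetI)
  fix p assume p: "p \<in> nu_paths (hook (Suc A) b)"
  have "0 < b" using assms by simp
  from this p show "p \<in> {hook_pt A b k u w |u w. grid_point A b k u w}"
  proof (cases rule: nu_paths_hook_cases)
    case (col w)
    then have "p = hook_pt A b k 0 w" "grid_point A b k 0 w" by (auto simp: hook_pt_def grid_point_def)
    then show ?thesis by blast
  next
    case (arm u v)
    then have "p = hook_pt A b k u (bump k v)" "grid_point A b k u (bump k v)"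
      by (auto simp: hook_pt_bump grid_point_bump)
    then show ?thesis by blast
  qed
qed (use hook_pt_in_nu_paths assms in auto)

lemma replicate_append_eq_iff:
  assumes "x \<noteq> y"
  shows "replicate m x @ y # p = replicate n x @ y # q \<longleftrightarrow> m = n \<and> p = q"
proof (induction m arbitrary: n)
  case 0
  then show ?case using assms by (cases n) auto
next
  case (Suc m)
  then show ?case using assms by (cases n) auto
qed

lemma col_inject: "w \<le> b \<Longrightarrow> w' \<le> b \<Longrightarrow> col A b w = col A b w' \<longleftrightarrow> w = w'"
  by (auto simp: col_def replicate_append_eq_iff)

lemma arm_inject: "u \<le> A \<Longrightarrow> u' \<le> A \<Longrightarrow> arm A b u v = arm A b u' v' \<longleftrightarrow> u = u' \<and> v = v'"
proof -
  assume "u \<le> A" "u' \<le> A"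
  then have "A - u = A - u' \<longleftrightarrow> u = u'" by linarith
  then show ?thesis by (auto simp: arm_def replicate_append_eq_iff)
qed

text \<open>The height over the first column separates the two kinds: it is at least
  \<open>A\<close> for one and below \<open>A\<close> for the other.\<close>

lemma col_neq_arm:
  assumes "0 < u" "u \<le> A" "0 < b"
  shows "col A b w \<noteq> arm A b u v"
proof
  assume "col A b w = arm A b u v"
  then have "height (col A b w) 0 = height (arm A b u v) 0" by simp
  with assms show False by (simp add: height_col height_arm)
qed

lemma hook_pt_inject:
  assumes "k < b" "grid_point A b k u w" "grid_point A b k u' w'"
  shows "hook_pt A b k u w = hook_pt A b k u' w' \<longleftrightarrow> u = u' \<and> w = w'"
proof -
  let ?d = "\<lambda>w. if w < k then w else w - 1"
  have g: "u \<le> A" "w \<le> b" "u' \<le> A" "w' \<le> b" "0 < b"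
    and gk: "w = k \<Longrightarrow> u = 0" "w' = k \<Longrightarrow> u' = 0"
    using assms by (auto simp: grid_point_def)
  show ?thesis
  proof (cases "u = 0"; cases "u' = 0")
    assume "u = 0" "u' = 0"
    then show ?thesis using g by (simp add: hook_pt_def col_inject)
  next
    assume "u = 0" "u' \<noteq> 0"
    then show ?thesis using g col_neq_arm[of u' A b w "?d w'"] by (simp add: hook_pt_def)
  next
    assume "u \<noteq> 0" "u' = 0"
    then show ?thesis using g col_neq_arm[of u A b w' "?d w", symmetric] by (simp add: hook_pt_def)
  next
    assume "u \<noteq> 0" "u' \<noteq> 0"
    moreover from this have "w \<noteq> k" "w' \<noteq> k" using gk by auto
    then have "?d w = ?d w' \<longleftrightarrow> w = w'" by (auto split: if_splits)
    ultimately show ?thesis using g by (simp add: hook_pt_def arm_inject)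
  qed
qed

section \<open>Rotations of paths above the hook\<close>

text \<open>The change of altitude along a path that is preceded by \<open>n\<close> north steps.\<close>

primrec rise :: "int list \<Rightarrow> nat \<Rightarrow> path \<Rightarrow> int" where
  "rise \<delta> n [] = 0"
| "rise \<delta> n (s # p) = (case s of E \<Rightarrow> rise \<delta> n p - 1 | N \<Rightarrow> \<delta> ! n + rise \<delta> (Suc n) p)"

lemma rise_append: "rise \<delta> n (p @ q) = rise \<delta> n p + rise \<delta> (n + count_list p N) q"
  by (induction p arbitrary: n) (auto split: step.split)

lemma altitude_eq_rise: "i \<le> length p \<Longrightarrow> altitude \<delta> p i = rise \<delta> 0 (take i p)"
  by (induction i) (auto simp: take_Suc_conv_app_nth rise_append split: step.split)

declare altitude.simps [simp del]

text \<open>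
  \<open>N # q\<close> is the part of a path from the point \<open>x\<close> in a valley, reached with \<open>n\<close> north steps, up to
  the first later point of the same altitude.
\<close>

definition returns :: "int list \<Rightarrow> nat \<Rightarrow> path \<Rightarrow> bool" where
  "returns \<delta> n q \<longleftrightarrow> rise \<delta> n (N # q) = 0 \<and>
     (\<forall>r s. q = r @ s \<and> s \<noteq> [] \<longrightarrow> rise \<delta> n (N # r) \<noteq> 0)"

text \<open>Of two prefixes of the same word one extends the other, and a proper extension would
  contain an earlier return. Hence a valley admits at most one rotation.\<close>

lemma returns_unique:
  assumes "returns \<delta> n q" "returns \<delta> n q'" "q @ r = q' @ r'"
  shows "q = q' \<and> r = r'"
proof -
  from assms(3) consider s where "q = q' @ s" "s @ r = r'" | s where "q @ s = q'" "r = s @ r'"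
    by (auto simp: append_eq_append_conv2)
  moreover have "t = []" if "returns \<delta> n (p @ t)" "returns \<delta> n p" for p t
    using that unfolding returns_def by blast
  ultimately show ?thesis using assms(1,2) by (metis append.right_neutral append_Nil)
qed

text \<open>Replaces step indices by a factorization of the word: the point \<open>x\<close> lies
  between \<open>E\<close> and \<open>N\<close>, the point \<open>y\<close> between \<open>q\<close>
  and \<open>s\<close>.\<close>

lemma rotation_iff:
  "rotation \<delta> p p' \<longleftrightarrow> (\<exists>r q s. p = r @ E # N # q @ s \<and> returns \<delta> (count_list r N) q \<and>
     p' = r @ N # q @ E # s)" (is "_ \<longleftrightarrow> ?R")
proof
  assume "rotation \<delta> p p'"
  then obtain i j where ij: "Suc i < length p" "p ! i = E" "p ! Suc i = N" "Suc i < j" "j \<le> length p"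
    and alt: "altitude \<delta> p j = altitude \<delta> p (Suc i)"
    and no: "\<And>m. Suc i < m \<Longrightarrow> m < j \<Longrightarrow> altitude \<delta> p m \<noteq> altitude \<delta> p (Suc i)"
    and p': "p' = take i p @ drop (Suc i) (take j p) @ [E] @ drop j p"
    unfolding rotation_def by blast
  define r q s where "r = take i p" and "q = take (j - Suc (Suc i)) (drop (Suc (Suc i)) p)" and "s = drop j p"
  have p: "p = r @ E # N # q @ s"
  proof -
    have "p = take i p @ p ! i # p ! Suc i # drop (Suc (Suc i)) p"
    proof -
      have "p = take i p @ drop i p" by simp
      also have "drop i p = p ! i # p ! Suc i # drop (Suc (Suc i)) p"
        using ij by (metis Cons_nth_drop_Suc Suc_lessD)
      finally show ?thesis .
    qed
    moreover have "j - Suc (Suc i) + Suc (Suc i) = j" using ij by linarith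
    then have "drop (Suc (Suc i)) p = q @ s"
      using append_take_drop_id[of "j - Suc (Suc i)" "drop (Suc (Suc i)) p", symmetric]
      by (simp only: q_def s_def drop_drop)
    ultimately show ?thesis using ij by (simp add: r_def)
  qed
  have len: "length r = i" "length q = j - Suc (Suc i)" using ij by (simp_all add: r_def q_def)
  then have j: "j = Suc (Suc i) + length q" using ij by linarith
  have drop: "drop (Suc i) (take j p) = N # q"
    using len ij(4) by (subst p) (simp add: take_Cons' drop_Cons')
  have alts: "altitude \<delta> p (Suc (Suc i) + length t) = altitude \<delta> p (Suc i) + rise \<delta> (count_list r N) (N # t)"
    if t: "q = t @ t'" for t t'
  proof -
    have "take (Suc i) p = r @ [E]" "take (Suc (Suc i) + length t) p = r @ E # N # t"
      unfolding p t using len by (simp_all add: take_Cons')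
    moreover have "Suc (Suc i) + length t \<le> length p" unfolding p t using len by simp
    ultimately show ?thesis using ij by (simp add: altitude_eq_rise rise_append)
  qed
  have "returns \<delta> (count_list r N) q"
    unfolding returns_def
  proof (intro conjI allI impI)
    show "rise \<delta> (count_list r N) (N # q) = 0"
      using alts[of q "[]"] alt unfolding j by simp
    fix t t' assume "q = t @ t' \<and> t' \<noteq> []"
    then show "rise \<delta> (count_list r N) (N # t) \<noteq> 0"
      using alts[of t t'] no[of "Suc (Suc i) + length t"] unfolding j by auto
  qed
  moreover have "p' = r @ N # q @ E # s" using p' drop by (simp add: r_def s_def)
  ultimately show ?R using p by blast
next
  assume ?R
  then obtain r q s where p: "p = r @ E # N # q @ s" and ret: "returns \<delta> (count_list r N) q"
    and p': "p' = r @ N # q @ E # s" by blast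
  let ?i = "length r" and ?j = "Suc (Suc (length r)) + length q"
  have alts: "altitude \<delta> p (Suc (Suc ?i) + l) = altitude \<delta> p (Suc ?i) + rise \<delta> (count_list r N) (N # take l q)"
    if "l \<le> length q" for l
  proof -
    have "take (Suc ?i) p = r @ [E]" "take (Suc (Suc ?i) + l) p = r @ E # N # take l q"
      unfolding p using that by (simp_all add: take_Cons')
    moreover have "Suc (Suc ?i) + l \<le> length p" "Suc ?i \<le> length p" unfolding p using that by simp_all
    ultimately show ?thesis by (simp add: altitude_eq_rise rise_append)
  qed
  show "rotation \<delta> p p'"
    unfolding rotation_def
  proof (rule exI[of _ ?i], rule exI[of _ ?j], intro conjI allI impI)
    show "altitude \<delta> p ?j = altitude \<delta> p (Suc ?i)"
      using alts[of "length q"] ret by (simp add: returns_def)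
    fix m assume m: "Suc ?i < m \<and> m < ?j"
    define l where "l = m - Suc (Suc ?i)"
    have l: "m = Suc (Suc ?i) + l" "l < length q" using m by (auto simp: l_def)
    then have "q = take l q @ drop l q" "drop l q \<noteq> []" by simp_all
    then have "rise \<delta> (count_list r N) (N # take l q) \<noteq> 0"
      using ret unfolding returns_def by blast
    then show "altitude \<delta> p m \<noteq> altitude \<delta> p (Suc ?i)"
      using alts[of l] l by simp
  qed (simp_all add: p p' nth_append take_Cons' drop_Cons')
qed

text \<open>The rotation at one given valley: \<open>r\<close> is what precedes its \<open>E\<close>
  and \<open>t\<close> what follows its \<open>N\<close>.\<close>

definition rotates_at :: "int list \<Rightarrow> path \<Rightarrow> path \<Rightarrow> path \<Rightarrow> bool" where
  "rotates_at \<delta> r t p' \<longleftrightarrow> (\<exists>q s. t = q @ s \<and> returns \<delta> (count_list r N) q \<and> p' = r @ N # q @ E # s)"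

lemma rotation_iff_valley:
  "rotation \<delta> p p' \<longleftrightarrow> (\<exists>r t. p = r @ E # N # t \<and> rotates_at \<delta> r t p')"
  unfolding rotation_iff rotates_at_def by blast

lemma rotates_at_iff:
  assumes "returns \<delta> (count_list r N) q"
  shows "rotates_at \<delta> r (q @ s) p' \<longleftrightarrow> p' = r @ N # q @ E # s"
  unfolding rotates_at_def using assms returns_unique[OF assms] by blast

lemma rise_zero:
  assumes "\<And>m. n \<le> m \<Longrightarrow> m < n + count_list p N \<Longrightarrow> \<delta> ! m = 0"
  shows "rise \<delta> n p = - int (count_list p E)"
  using assms
proof (induction p arbitrary: n)
  case (Cons s p)
  show ?case
  proof (cases s)
    case N
    then have "\<delta> ! n = 0" using Cons.prems[of n] by simp
    moreover have "rise \<delta> (Suc n) p = - int (count_list p E)"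
      using Cons.prems N by (intro Cons.IH) auto
    ultimately show ?thesis using N by simp
  next
    case E
    then show ?thesis using Cons.IH[of n] Cons.prems by simp
  qed
qed simp

text \<open>The north step at the valley gains as much altitude as the east steps of
  \<open>q\<close> lose, and the other north steps of \<open>q\<close> gain nothing. The altitude
  therefore never rises along \<open>q\<close>, and the final east step excludes an earlier
  return.\<close>

lemma returnsI:
  assumes "\<delta> ! n = int (count_list q E)" "q = [] \<or> last q = E"
    and "\<And>m. Suc n \<le> m \<Longrightarrow> m < Suc n + count_list q N \<Longrightarrow> \<delta> ! m = 0"
  shows "returns \<delta> n q"
  unfolding returns_def
proof (intro conjI allI impI)
  show "rise \<delta> n (N # q) = 0" using assms by (simp add: rise_zero)
  fix r s assume rs: "q = r @ s \<and> s \<noteq> []"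
  have "rise \<delta> (Suc n) r = - int (count_list r E)"
    using assms(3) rs by (intro rise_zero) auto
  moreover have "last s = E" using assms(2) rs by auto
  then have "count_list s E \<noteq> 0" using rs last_in_set[of s] by (auto simp: count_list_0_iff)
  ultimately show "rise \<delta> n (N # r) \<noteq> 0" using assms(1) rs by simp
qed

text \<open>The increment \<open>k\<close> belongs to the last but one of the \<open>Suc A\<close>
  north steps, with index \<open>A - 1\<close>. For \<open>A = 0\<close> there is no such
  step.\<close>

lemma hook_delta_nth:
  "n \<le> A \<Longrightarrow> hook_delta (Suc A) k ! n = (if Suc n = A then int k else 0)"
  by (auto simp: hook_delta_def nth_append nth_Cons' less_Suc_eq_le)

section \<open>Valleys and rotations of the two kinds of paths\<close>

lemma replicate_N_append_eq:
  "replicate n N @ q = r @ E # s \<longleftrightarrow> (\<exists>r'. r = replicate n N @ r' \<and> q = r' @ E # s)"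
proof (induction n arbitrary: r)
  case (Suc n)
  show ?case using Suc by (cases r) auto
qed simp

lemma replicate_E_valley:
  "replicate m E @ N # replicate n E = r @ E # N # s \<longleftrightarrow> 0 < m \<and> r = replicate (m - 1) E \<and> s = replicate n E"
proof (induction m arbitrary: r)
  case 0
  have False if "replicate n E = t @ E # N # s" for t
    using arg_cong[OF that, of set] by (auto split: if_splits)
  then show ?case by (cases r) auto
next
  case (Suc m)
  show ?case
  proof (cases r)
    case Nil
    then show ?thesis by (cases m) auto
  next
    case (Cons x r')
    then show ?thesis using Suc[of r'] by (cases m) auto
  qed
qed

lemma valley_col:
  "col A b w = r @ E # N # t \<longleftrightarrow>
     0 < w \<and> r = replicate A N @ replicate (w - 1) E \<and> t = replicate (b - w) E"
  unfolding col_def replicate_N_append_eq replicate_E_valley by auto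

lemma valley_arm:
  assumes "0 < u"
  shows "arm A b u v = r @ E # N # t \<longleftrightarrow>
     r = replicate (A - u) N \<and> t = replicate (u - 1) N @ replicate v E @ N # replicate (b - 1 - v) E \<or>
     0 < v \<and> r = replicate (A - u) N @ E # replicate u N @ replicate (v - 1) E \<and> t = replicate (b - 1 - v) E"
proof -
  have *: "E # replicate u N @ replicate v E @ N # replicate (b - 1 - v) E = r' @ E # N # t \<longleftrightarrow>
     r' = [] \<and> t = replicate (u - 1) N @ replicate v E @ N # replicate (b - 1 - v) E \<or>
     0 < v \<and> r' = E # replicate u N @ replicate (v - 1) E \<and> t = replicate (b - 1 - v) E" for r'
  proof (cases r')
    case Nil
    with assms show ?thesis by (cases u) auto
  next
    case (Cons x r'')
    then show ?thesis by (auto simp: replicate_N_append_eq replicate_E_valley)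
  qed
  show ?thesis unfolding arm_def replicate_N_append_eq * by auto
qed

text \<open>The only possible valley precedes the last north step, whose increment is 0. The return
  is immediate and the rotation just swaps \<open>E\<close> and \<open>N\<close>.\<close>

lemma rotation_col:
  assumes "w \<le> b"
  shows "rotation (hook_delta (Suc A) k) (col A b w) p \<longleftrightarrow> 0 < w \<and> p = col A b (w - 1)"
proof -
  let ?r = "replicate A N @ replicate (w - 1) E"
  have ret: "returns (hook_delta (Suc A) k) (count_list ?r N) []"
    by (rule returnsI) (simp_all add: hook_delta_nth count_list_replicate)
  have "rotation (hook_delta (Suc A) k) (col A b w) p \<longleftrightarrow>
    0 < w \<and> rotates_at (hook_delta (Suc A) k) ?r (replicate (b - w) E) p"
    unfolding rotation_iff_valley valley_col by blast
  also have "\<dots> \<longleftrightarrow> 0 < w \<and> p = ?r @ N # E # replicate (b - w) E"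
    using rotates_at_iff[OF ret, of "replicate (b - w) E" p] by simp
  also have "\<dots> \<longleftrightarrow> 0 < w \<and> p = col A b (w - 1)"
  proof (cases w)
    case (Suc v)
    then have "b - v = Suc (b - w)" using assms by simp
    then show ?thesis using Suc by (simp add: col_def)
  qed simp
  finally show ?thesis .
qed

text \<open>The north step at the first valley has index \<open>A - u\<close>, so its increment is 0
  unless \<open>u = 1\<close>, when it is \<open>k\<close>. In that case the returning subpath uses
  up \<open>k\<close> east steps, and whether these reach beyond the last north step decides between
  \<open>v\<close> and \<open>Suc v\<close>: this is the origin of \<open>bump\<close>.\<close>

lemma rotation_arm:
  assumes "0 < u" "u \<le> A" "v < b" "k < b"
  shows "rotation (hook_delta (Suc A) k) (arm A b u v) p \<longleftrightarrow>
    p = (if u = 1 then col A b (bump k v) else arm A b (u - 1) v) \<or> 0 < v \<and> p = arm A b u (v - 1)"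
proof -
  let ?\<delta> = "hook_delta (Suc A) k"
  let ?r1 = "replicate (A - u) N" and ?t1 = "replicate (u - 1) N @ replicate v E @ N # replicate (b - 1 - v) E"
  let ?r2 = "replicate (A - u) N @ E # replicate u N @ replicate (v - 1) E" and ?t2 = "replicate (b - 1 - v) E"
  have 1: "rotates_at ?\<delta> ?r1 ?t1 p \<longleftrightarrow>
    p = (if u = 1 then col A b (bump k v) else arm A b (u - 1) v)"
  proof (cases "u = 1")
    case False
    have ret: "returns ?\<delta> (count_list ?r1 N) []"
      by (rule returnsI) (use False assms in \<open>auto simp: hook_delta_nth count_list_replicate\<close>)
    have "arm A b (u - 1) v = ?r1 @ N # [] @ E # ?t1"
    proof -
      have "replicate (A - (u - 1)) N = ?r1 @ [N]"
        using assms by (simp add: replicate_append_same Suc_diff_le)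
      then show ?thesis by (simp add: arm_def)
    qed
    then show ?thesis using rotates_at_iff[OF ret, of ?t1 p] False by simp
  next
    case u: True
    show ?thesis
    proof (cases "v < k")
      case True
      \<comment> \<open>The run of \<open>v\<close> east steps is too short, so the subpath also
        takes the last north step and \<open>k - v\<close> east steps after it.\<close>
      let ?q = "replicate v E @ N # replicate (k - v) E"
      have ret: "returns ?\<delta> (count_list ?r1 N) ?q"
        by (rule returnsI) (use True assms u in \<open>auto simp: hook_delta_nth count_list_replicate\<close>)
      have t1: "?t1 = ?q @ replicate (b - 1 - k) E"
        using True assms u by (simp add: replicate_add[symmetric])
      have "col A b v = ?r1 @ N # ?q @ E # replicate (b - 1 - k) E"
      proof -
        have "replicate A N = ?r1 @ [N]" using assms u by (cases A) (simp_all add: replicate_append_same)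
        moreover have "replicate (b - v) E = replicate (k - v) E @ E # replicate (b - 1 - k) E"
        proof -
          have "b - v = (k - v) + Suc (b - 1 - k)" using True assms by linarith
          then show ?thesis by (simp only: replicate_add replicate_Suc)
        qed
        ultimately show ?thesis by (simp add: col_def)
      qed
      then show ?thesis using rotates_at_iff[OF ret, of "replicate (b - 1 - k) E" p] u True
        unfolding t1 by (simp add: bump_def)
    next
      case False
      \<comment> \<open>The return happens before the last north step, and the displaced
        \<open>E\<close> joins the run in front of it.\<close>
      let ?q = "replicate k E"
      let ?s = "replicate (v - k) E @ N # replicate (b - 1 - v) E"
      have "?q = [] \<or> last ?q = E" by (cases "k = 0") simp_all
      then have ret: "returns ?\<delta> (count_list ?r1 N) ?q"
        by (intro returnsI) (use False assms u in \<open>auto simp: hook_delta_nth count_list_replicate\<close>)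
      have t1: "?t1 = ?q @ ?s"
      proof -
        have "replicate v E = replicate k E @ replicate (v - k) E"
          using False by (simp add: replicate_add[symmetric])
        then show ?thesis using u by simp
      qed
      have "col A b (Suc v) = ?r1 @ N # ?q @ E # ?s"
      proof -
        have "replicate A N = ?r1 @ [N]" using assms u by (cases A) (simp_all add: replicate_append_same)
        moreover have "replicate (Suc v) E = replicate k E @ E # replicate (v - k) E"
          using False unfolding replicate_Suc[symmetric] replicate_add[symmetric] by simp
        ultimately show ?thesis by (simp add: col_def del: replicate_Suc)
      qed
      then show ?thesis using rotates_at_iff[OF ret, of ?s p] u False
        unfolding t1 by (simp add: bump_def)
    qed
  qed
  have ret: "returns ?\<delta> (count_list ?r2 N) []"
    by (rule returnsI) (use assms in \<open>auto simp: hook_delta_nth count_list_replicate\<close>)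
  have 2: "rotates_at ?\<delta> ?r2 ?t2 p \<longleftrightarrow>
      p = arm A b u (v - 1)" if "0 < v"
  proof -
    have "replicate (b - 1 - (v - 1)) E = E # ?t2"
      using that assms unfolding replicate_Suc[symmetric] by (simp add: Suc_diff_Suc)
    then have "arm A b u (v - 1) = ?r2 @ N # [] @ E # ?t2" by (simp add: arm_def)
    then show ?thesis using rotates_at_iff[OF ret, of ?t2 p] by simp
  qed
  have "rotation ?\<delta> (arm A b u v) p \<longleftrightarrow>
    rotates_at ?\<delta> ?r1 ?t1 p \<or>
    0 < v \<and> rotates_at ?\<delta> ?r2 ?t2 p"
    unfolding rotation_iff_valley valley_arm[OF assms(1)] by blast
  then show ?thesis using 1 2 by blast
qed

section \<open>The order generated by the rotations\<close>

context
  fixes A b k :: nat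
  assumes k: "k < b"
begin

private abbreviation (input) "grid \<equiv> grid_point A b k"
private abbreviation (input) "pt \<equiv> hook_pt A b k"

definition hook_step :: "path \<Rightarrow> path \<Rightarrow> bool" where
  "hook_step p q \<longleftrightarrow> p \<in> nu_paths (hook (Suc A) b) \<and> q \<in> nu_paths (hook (Suc A) b) \<and>
     rotation (hook_delta (Suc A) k) p q"

lemma rotation_pt_0: "w \<le> b \<Longrightarrow> rotation (hook_delta (Suc A) k) (pt 0 w) q \<longleftrightarrow> 0 < w \<and> q = pt 0 (w - 1)"
  by (simp add: hook_pt_def rotation_col)

text \<open>In the shifted coordinate the exceptional behaviour at \<open>u = 1\<close> disappears:
  the first valley lowers \<open>u\<close> and leaves \<open>w\<close> fixed.\<close>

lemma rotation_pt_bump: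
  assumes "0 < u" "u \<le> A" "v < b"
  shows "rotation (hook_delta (Suc A) k) (pt u (bump k v)) q \<longleftrightarrow>
    q = pt (u - 1) (bump k v) \<or> 0 < v \<and> q = pt u (bump k (v - 1))"
proof -
  have "pt (u - 1) (bump k v) = (if u = 1 then col A b (bump k v) else arm A b (u - 1) v)"
    using assms hook_pt_bump[of "u - 1" A b k v] by (simp add: hook_pt_def)
  then show ?thesis using assms k by (simp add: rotation_arm hook_pt_bump)
qed

lemma hook_step_decreasing:
  assumes "grid u w" "hook_step (pt u w) q"
  shows "\<exists>u' w'. grid u' w' \<and> q = pt u' w' \<and> u' \<le> u \<and> w' \<le> w"
  using assms(1) k
proof (cases rule: grid_point_cases)
  case special
  then have "q = pt 0 (w - 1)" using assms(2) k by (simp add: hook_step_def rotation_pt_0)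
  moreover have "grid 0 (w - 1)" using assms(1) by (auto simp: grid_point_def)
  ultimately show ?thesis using special(1) by (metis diff_le_self order_refl)
next
  case (bump v)
  show ?thesis
  proof (cases "u = 0")
    case True
    have "w \<le> b" using assms(1) by (auto simp: grid_point_def)
    then have "q = pt 0 (w - 1)" using assms(2) True by (simp add: hook_step_def rotation_pt_0)
    moreover have "grid 0 (w - 1)" using \<open>w \<le> b\<close> by (auto simp: grid_point_def)
    ultimately show ?thesis using True by (metis diff_le_self order_refl)
  next
    case False
    have u: "u \<le> A" using assms(1) by (auto simp: grid_point_def)
    from False u bump assms(2) consider "q = pt (u - 1) (bump k v)" | "0 < v" "q = pt u (bump k (v - 1))"
      by (auto simp: hook_step_def rotation_pt_bump)
    then show ?thesis
    proof cases
      case 1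
      moreover have "grid (u - 1) w" using bump u by (simp add: grid_point_bump)
      ultimately show ?thesis using bump(2) diff_le_self by blast
    next
      case 2
      moreover from 2 have "grid u (bump k (v - 1))" using bump u by (simp add: grid_point_bump)
      moreover have "bump k (v - 1) \<le> w" using bump by (auto simp: bump_def)
      ultimately show ?thesis by blast
    qed
  qed
qed

lemma hook_step_left:
  assumes "grid u w" "0 < u"
  shows "hook_step (pt u w) (pt (u - 1) w)" "grid (u - 1) w"
proof -
  show g: "grid (u - 1) w" using assms by (auto simp: grid_point_def)
  from assms(1) k show "hook_step (pt u w) (pt (u - 1) w)"
  proof (cases rule: grid_point_cases)
    case (bump v)
    moreover have "u \<le> A" using assms by (auto simp: grid_point_def)
    ultimately have "rotation (hook_delta (Suc A) k) (pt u w) (pt (u - 1) w)"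
      using assms by (simp add: rotation_pt_bump)
    then show ?thesis using assms(1) g k by (simp add: hook_step_def hook_pt_in_nu_paths)
  qed (use assms in simp)
qed

lemma hook_steps_left:
  assumes "grid u w" "u' \<le> u"
  shows "hook_step\<^sup>*\<^sup>* (pt u w) (pt u' w)"
  using assms(2,1)
proof (induction rule: inc_induct)
  case (step n)
  have "grid (Suc n) w" using step by (auto simp: grid_point_def)
  then have "hook_step (pt (Suc n) w) (pt n w)" using hook_step_left(1)[of "Suc n" w] by simp
  with step show ?case by (meson rtranclp.rtrancl_into_rtrancl)
qed simp

lemma hook_steps_down:
  assumes "grid u w" "grid u w'" "w' \<le> w"
  shows "hook_step\<^sup>*\<^sup>* (pt u w) (pt u w')"
  using assms
proof (induction w rule: less_induct)
  case (less w)
  show ?case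
  proof (cases "w' = w")
    case False
    have bounds: "u \<le> A" "w \<le> b" "w' < w" using less.prems False by (auto simp: grid_point_def)
    \<comment> \<open>\<open>y\<close> is the predecessor of \<open>w\<close> among the second
      coordinates available at \<open>u\<close>, so it jumps over \<open>k\<close> when
      \<open>u > 0\<close>.\<close>
    obtain y where y: "grid u y" "rotation (hook_delta (Suc A) k) (pt u w) (pt u y)" "w' \<le> y" "y < w"
    proof (cases "u = 0")
      case True
      then show thesis
        using that[of "w - 1"] bounds by (auto simp: rotation_pt_0 grid_point_def)
    next
      case False
      with less.prems(1,2) have "w \<noteq> k" "w' \<noteq> k" by (auto simp: grid_point_def)
      obtain v where v: "v < b" "w = bump k v"
        using less.prems(1) k \<open>w \<noteq> k\<close> by (auto elim: grid_point_cases)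
      have "0 < v" using bounds \<open>w' \<noteq> k\<close> v by (auto simp: bump_def split: if_splits)
      moreover have "w' \<le> bump k (v - 1)" "bump k (v - 1) < w"
        using bounds \<open>w' \<noteq> k\<close> v \<open>0 < v\<close> by (auto simp: bump_def split: if_splits)
      ultimately show thesis
        using that[of "bump k (v - 1)"] False bounds v by (simp add: grid_point_bump rotation_pt_bump)
    qed
    then have "hook_step (pt u w) (pt u y)"
      using less.prems(1) k by (simp add: hook_step_def hook_pt_in_nu_paths)
    moreover have "hook_step\<^sup>*\<^sup>* (pt u y) (pt u w')" using less.IH[of y] less.prems y by simp
    ultimately show ?thesis by (rule converse_rtranclp_into_rtranclp)
  qed simp
qed

text \<open>Rotations never increase a coordinate. Conversely, first lower \<open>u\<close> at
  constant \<open>w\<close>, then lower \<open>w\<close>.\<close>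

lemma hook_steps_iff:
  assumes "grid u w" "grid u' w'"
  shows "hook_step\<^sup>*\<^sup>* (pt u w) (pt u' w') \<longleftrightarrow> u' \<le> u \<and> w' \<le> w"
proof
  assume "hook_step\<^sup>*\<^sup>* (pt u w) (pt u' w')"
  moreover have "\<exists>x y. grid x y \<and> q = pt x y \<and> x \<le> u \<and> y \<le> w" if "hook_step\<^sup>*\<^sup>* (pt u w) q" for q
    using that
  proof induction
    case base
    then show ?case using assms by blast
  next
    case (step q r)
    then obtain x y where xy: "grid x y" "q = pt x y" "x \<le> u" "y \<le> w" by blast
    then obtain x' y' where "grid x' y'" "r = pt x' y'" "x' \<le> x" "y' \<le> y"
      using hook_step_decreasing step.hyps(2) by blast
    moreover from this xy have "x' \<le> u" "y' \<le> w" by simp_all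
    ultimately show ?case by blast
  qed
  ultimately obtain x y where "grid x y" "pt u' w' = pt x y" "x \<le> u" "y \<le> w" by blast
  then show "u' \<le> u \<and> w' \<le> w" using hook_pt_inject[OF k assms(2)] by simp
next
  assume le: "u' \<le> u \<and> w' \<le> w"
  show "hook_step\<^sup>*\<^sup>* (pt u w) (pt u' w')"
  proof (cases "grid u' w")
    case True
    then show ?thesis
      using hook_steps_left[of u w u'] hook_steps_down[of u' w w'] le assms by (meson rtranclp_trans)
  next
    case False
    \<comment> \<open>The intermediate point is missing only if \<open>w = k\<close> and
      \<open>u' > 0\<close>, but \<open>w = k\<close> gives \<open>u = 0\<close>, contradicting
      \<open>u' \<le> u\<close>.\<close>
    then show ?thesis using le assms by (auto simp: grid_point_def)
  qed
qed

lemma hook_grid_alt_hook_Tamari: "hook_grid (alt_hook_Tamari (Suc A) b k) pt A b k"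
proof
  show "carrier (alt_hook_Tamari (Suc A) b k) = {pt u w |u w. grid u w}"
    using k by (simp add: alt_hook_Tamari_def Tam_def nu_paths_hook)
  show "(.=\<^bsub>alt_hook_Tamari (Suc A) b k\<^esub>) = (=)"
    by (simp add: alt_hook_Tamari_def Tam_def)
  fix u w u' w' assume "grid u w" "grid u' w'"
  then show "pt u w \<sqsubseteq>\<^bsub>alt_hook_Tamari (Suc A) b k\<^esub> pt u' w' \<longleftrightarrow> u' \<le> u \<and> w' \<le> w"
    using hook_steps_iff[of u w u' w'] by (simp add: alt_hook_Tamari_def Tam_def hook_step_def[abs_def])
qed (fact k)

end

section \<open>Orbit sums\<close>

lemma bump_0_less: "bump k v > 0 \<longleftrightarrow> k = 0 \<or> 0 < v"
  by (auto simp: bump_def)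

lemma bump_less_iff: "k < b \<Longrightarrow> bump k v < b \<longleftrightarrow> v < b - 1"
  by (auto simp: bump_def)

lemma peak_col: "w \<le> b \<Longrightarrow> peak (col A b w) = of_bool (0 < A \<and> 0 < w) + of_bool (w < b)"
  by (auto simp: col_def path_stat_simps)

lemma peak_arm: "peak (arm A b u v) = of_bool (u < A) + of_bool (0 < u \<and> 0 < v) + of_bool (v < b - 1)"
  by (auto simp: arm_def path_stat_simps)

lemma val_col: "val (col A b w) = of_bool (0 < w)"
  by (auto simp: col_def path_stat_simps)

lemma val_arm: "0 < u \<Longrightarrow> val (arm A b u v) = 1 + of_bool (0 < v)"
  by (auto simp: arm_def path_stat_simps)

lemma sum_of_bool_le: "(\<Sum>x<n. of_bool (c \<le> x)) = n - (c :: nat)"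
  by (induction n) auto

lemma area_hook:
  assumes "0 < b"
  shows "area (hook (Suc A) b) p = height p 0 + (\<Sum>x<b - 1. height p (Suc x) - A)"
proof -
  from assms obtain c where "b = Suc c" by (cases b) auto
  then show ?thesis by (simp add: area_eq_sum count_hook height_hook sum.lessThan_Suc_shift del: sum.lessThan_Suc)
qed

lemma area_col:
  assumes "w \<le> b" "0 < b"
  shows "area (hook (Suc A) b) (col A b w) = A + b - w"
proof -
  \<comment> \<open>For \<open>w = 0\<close> the truncated \<open>w - 1\<close> is still right: all
    later columns count 1, and the remaining square is in column 0.\<close>
  have "(\<Sum>x<b - 1. height (col A b w) (Suc x) - A) = (\<Sum>x<b - 1. of_bool (w - 1 \<le> x))"
    by (rule sum.cong) (auto simp: height_col)
  then show ?thesis using assms by (simp add: area_hook sum_of_bool_le height_col)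
qed

lemma area_arm:
  assumes "u \<le> A" "v < b"
  shows "area (hook (Suc A) b) (arm A b u v) = A - u + (b - 1 - v)"
proof -
  have "(\<Sum>x<b - 1. height (arm A b u v) (Suc x) - A) = (\<Sum>x<b - 1. of_bool (v \<le> x))"
    using assms by (intro sum.cong) (auto simp: height_arm)
  then show ?thesis using assms by (simp add: area_hook sum_of_bool_le height_arm)
qed

text \<open>If the same formula in the size of the orbit holds in both lattices, orbits of equal
  size have equal sums. Independence of the increment vector and homometry both follow.\<close>

lemma same_orbit_sumsI:
  assumes "\<And>Q. Q \<in> row_orbits L \<Longrightarrow> real (\<Sum>z\<in>Q. f z) = s + (if card Q = l then 0 else t)"
    and "\<And>Q. Q \<in> row_orbits L' \<Longrightarrow> real (\<Sum>z\<in>Q. f' z) = s + (if card Q = l then 0 else t)"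
  shows "same_orbit_sums L f L' f'"
  unfolding same_orbit_sums_def
proof (intro ballI impI)
  fix Q Q' assume "Q \<in> row_orbits L" "Q' \<in> row_orbits L'" "card Q = card Q'"
  then have "real (\<Sum>z\<in>Q. f z) = real (\<Sum>z\<in>Q'. f' z)" using assms by simp
  then show "(\<Sum>z\<in>Q. f z) = (\<Sum>z\<in>Q'. f' z)" by (simp only: of_nat_eq_iff)
qed

section \<open>Orbit sums for the alt hook-Tamari lattice\<close>

context
  fixes a b k :: nat
  assumes a: "0 < a" and k: "k < b" and ak: "a = 1 \<longrightarrow> k = 0"
begin

private abbreviation (input) "H \<equiv> alt_hook_Tamari a b k"
private abbreviation (input) "g \<equiv> gcd a b"
private abbreviation (input) "l \<equiv> lcm a b"

private lemma Suc_pred_a: "Suc (a - 1) = a"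
  using a by simp

private lemma grid_H: "hook_grid H (hook_pt (a - 1) b k) (a - 1) b k"
  using hook_grid_alt_hook_Tamari[OF k, of "a - 1"] by (simp only: Suc_pred_a)

private lemma b_pos: "0 < b"
  using k by simp

lemmas alt_hook_row_orbit_sizes = hook_grid.row_orbit_sizes[OF grid_H, unfolded Suc_pred_a]

private lemmas sum_row_orbit_H = hook_grid.sum_row_orbit[OF grid_H, unfolded Suc_pred_a]

private lemma bump_le: "v < b \<Longrightarrow> bump k v \<le> b"
  by (simp add: bump_def)

lemma alt_hook_sum_ddeg:
  assumes "Q \<in> row_orbits H"
  shows "real (\<Sum>z\<in>Q. ddeg H z) =
    (2 * real a * real b - real a - real b) / real g + (if card Q = l then 0 else 1)"
proof -
  have "real b * real (a - 1) + real a * (real b - 1) = 2 * real a * real b - real a - real b"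
    using a by (simp add: of_nat_diff algebra_simps)
  with hook_grid.sum_ddeg[OF grid_H assms, unfolded Suc_pred_a] show ?thesis by simp
qed

lemma alt_hook_sum_peak:
  assumes "Q \<in> row_orbits H"
  shows "real (\<Sum>z\<in>Q. peak z) =
    (3 * real a * real b - 2 * real a - 2 * real b) / real g + (if card Q = l then 0 else 2)"
proof -
  \<comment> \<open>For \<open>u > 0\<close> the product of the indicators of \<open>0 < u\<close>
    and \<open>0 < v\<close> is \<open>1 - of_bool (v = 0)\<close>, and
    \<open>- of_bool (u = 0)\<close> removes the 1 on the row \<open>u = 0\<close>. What remains is
    a defect of 1 at \<open>(0, 0)\<close>, present only for \<open>k = 0\<close>.\<close>
  define F where "F u = of_bool (u < a - 1) - (of_bool (u = 0) :: real)" for u :: nat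
  define G where "G v = 1 + of_bool (v < b - 1) - (of_bool (v = 0) :: real)" for v :: nat
  have "real (peak (hook_pt (a - 1) b k u (bump k v))) = F u + G v +
      (if u = 0 \<and> v = k then of_bool (k = 0) else 0)" if "u \<le> a - 1" "v < b" for u v
  proof (cases "u = 0")
    case True
    have "peak (hook_pt (a - 1) b k u (bump k v)) =
        of_bool (0 < a - 1 \<and> (k = 0 \<or> 0 < v)) + of_bool (v < b - 1)"
      using True that k by (simp add: hook_pt_def peak_col bump_le bump_0_less bump_less_iff)
    then show ?thesis using True ak a by (cases "a = 1"; cases "k = 0") (auto simp: F_def G_def)
  next
    case False
    then show ?thesis by (auto simp: hook_pt_bump peak_arm F_def G_def)
  qed
  note sum = sum_row_orbit_H[OF this assms]
  have "peak (hook_pt (a - 1) b k 0 k) = of_bool (0 < k) + 1"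
    using k ak a by (cases "a = 1") (auto simp: hook_pt_def peak_col)
  then have "of_bool (k = 0) + real (peak (hook_pt (a - 1) b k 0 k)) = 2" by auto
  moreover have "(\<Sum>u\<le>a - 1. F u) = real (a - 1) - 1"
    unfolding F_def sum_subtractf sum_of_bool_less_top sum_of_bool_eq_0 ..
  moreover have "(\<Sum>v<b. G v) = real b + (real b - 1) - 1"
    unfolding G_def sum_subtractf sum.distrib sum_of_bool_less_pred[OF b_pos] sum_of_bool_eq_0(2)[OF b_pos]
    by simp
  moreover have "real b * (real (a - 1) - 1) + real a * (real b + (real b - 1) - 1) =
      3 * real a * real b - 2 * real a - 2 * real b"
    using a by (simp add: of_nat_diff algebra_simps)
  ultimately show ?thesis using sum by (simp only:)
qed

lemma alt_hook_sum_val: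
  assumes "Q \<in> row_orbits H"
  shows "real (\<Sum>z\<in>Q. val z) =
    (2 * real a * real b - real a - real b) / real g + (if card Q = l then 0 else 1)"
proof -
  define F where "F u = (of_bool (0 < u) :: real)" for u :: nat
  have "real (val (hook_pt (a - 1) b k u (bump k v))) = F u + F v +
      (if u = 0 \<and> v = k then of_bool (k = 0) else 0)" if "u \<le> a - 1" "v < b" for u v
  proof (cases "u = 0")
    case True
    then show ?thesis by (auto simp: hook_pt_def val_col bump_0_less F_def)
  next
    case False
    then show ?thesis by (auto simp: hook_pt_bump val_arm F_def)
  qed
  note sum = sum_row_orbit_H[OF this assms]
  have "of_bool (k = 0) + real (val (hook_pt (a - 1) b k 0 k)) = 1"
    by (auto simp: hook_pt_def val_col)
  moreover have "(\<Sum>u\<le>a - 1. F u) = real (a - 1)" "(\<Sum>v<b. F v) = real b - 1"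
    unfolding F_def by (rule sum_of_bool_pos(1), rule sum_of_bool_pos(2)[OF b_pos])
  moreover have "real b * real (a - 1) + real a * (real b - 1) =
      2 * real a * real b - real a - real b"
    using a by (simp add: of_nat_diff algebra_simps)
  ultimately show ?thesis using sum by (simp only:)
qed

private lemma area_special: "area (hook a b) (hook_pt (a - 1) b k 0 k) = a - 1 + b - k"
  using area_col[of k b "a - 1"] k a by (simp add: hook_pt_def)

text \<open>The last term is the only obstruction to additivity. It vanishes for
  \<open>k = 0\<close>; for \<open>k = b - 1\<close> it is a function of \<open>u\<close> except at
  \<open>(0, k)\<close>.\<close>

private lemma area_cell:
  assumes "u \<le> a - 1" "v < b"
  shows "real (area (hook a b) (hook_pt (a - 1) b k u (bump k v))) =
    real (a - 1 - u) + real (b - 1 - v) + of_bool (u = 0 \<and> v < k)"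
proof (cases "u = 0")
  case True
  have "area (hook a b) (hook_pt (a - 1) b k u (bump k v)) = a - 1 + b - bump k v"
    using area_col[of "bump k v" b "a - 1"] True a assms by (simp add: hook_pt_def bump_le)
  also have "\<dots> = a - 1 + (b - 1 - v) + of_bool (v < k)"
    using assms by (auto simp: bump_def)
  finally show ?thesis using True by simp
next
  case False
  then show ?thesis using area_arm[of u "a - 1" v b] assms a by (simp add: hook_pt_bump)
qed

private lemma area_base:
  "(real b * (real (a - 1) * real a / 2) + real a * ((real b - 1) * real b / 2)) / real g =
    real l * ((real a + real b - 2) / 2)"
proof -
  have l: "real l = real a * real b / real g"
    using real_lcm_div(1)[OF a b_pos] a by (simp add: field_simps)
  have "real b * (real (a - 1) * real a / 2) + real a * ((real b - 1) * real b / 2) =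
      real a * real b * ((real a + real b - 2) / 2)"
    using a by (simp add: of_nat_diff field_simps)
  then show ?thesis unfolding l by (simp only: times_divide_eq_left)
qed

lemma alt_hook_sum_area_0:
  assumes "Q \<in> row_orbits H" "k = 0"
  shows "real (\<Sum>z\<in>Q. area (hook a b) z) =
    real l * ((real a + real b - 2) / 2) + (if card Q = l then 0 else real a + real b - 1)"
proof -
  have "real (area (hook a b) (hook_pt (a - 1) b k u (bump k v))) =
      real (a - 1 - u) + real (b - 1 - v) + (if u = 0 \<and> v = k then 0 else 0)"
    if "u \<le> a - 1" "v < b" for u v
    using area_cell[OF that] assms(2) by simp
  note sum = sum_row_orbit_H[OF this assms(1)]
  have "0 + real (area (hook a b) (hook_pt (a - 1) b k 0 k)) = real a + real b - 1"
    using area_special assms(2) a by (simp add: of_nat_diff)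
  with sum show ?thesis
    using area_base sum_distance_to_top(1)[of "a - 1"] sum_distance_to_top(2)[OF b_pos]
    by (simp only: Suc_pred_a)
qed

lemma alt_hook_sum_area_max:
  assumes "Q \<in> row_orbits H" "k = b - 1"
  shows "real (\<Sum>z\<in>Q. area (hook a b) z) =
    real l * ((real a + real b - 2) / 2 + 1 / real a) + (if card Q = l then 0 else real a - 1)"
proof -
  have "real (area (hook a b) (hook_pt (a - 1) b k u (bump k v))) =
      (real (a - 1 - u) + of_bool (u = 0)) + real (b - 1 - v) + (if u = 0 \<and> v = k then - 1 else 0)"
    if "u \<le> a - 1" "v < b" for u v
    using area_cell[OF that] assms(2) that by auto
  note sum = sum_row_orbit_H[OF this assms(1)]
  have "- 1 + real (area (hook a b) (hook_pt (a - 1) b k 0 k)) = real a - 1"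
    using area_special assms(2) a b_pos by (simp add: of_nat_diff)
  moreover have "(\<Sum>u\<le>a - 1. real (a - 1 - u) + of_bool (u = 0)) = real (a - 1) * real a / 2 + 1"
    using sum_distance_to_top(1)[of "a - 1"] sum_of_bool_eq_0(1)[of "a - 1"]
    by (simp only: sum.distrib Suc_pred_a)
  \<comment> \<open>The additional 1 in the row sum contributes \<open>b / g\<close>, which is
    \<open>l / a\<close>.\<close>
  moreover have "(real b * (real (a - 1) * real a / 2 + 1) + real a * ((real b - 1) * real b / 2)) / real g =
      real l * ((real a + real b - 2) / 2 + 1 / real a)"
    using area_base real_lcm_div(1)[OF a b_pos] by (simp add: add_divide_distrib distrib_left)
  ultimately show ?thesis
    using sum sum_distance_to_top(2)[OF b_pos] by (simp only:)
qed

end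

theorem theorem3p7:
  fixes a b k g l :: nat and \<nu> :: path and H :: "nat \<Rightarrow> path gorder"
  assumes "0 < a" and "0 < b" and "k \<le> b - 1" and "a = 1 \<longrightarrow> k = 0"
    and "g = gcd a b" and "l = lcm a b"
    and "\<nu> = hook a b" and "H = alt_hook_Tamari a b"
  shows
    "((\<forall>Q\<in>row_orbits (H k). card Q = l \<or> card Q = l + 1) \<and>
       card {Q \<in> row_orbits (H k). card Q = l} = g - 1 \<and>
       card {Q \<in> row_orbits (H k). card Q = l + 1} = 1) \<and>

     ((\<forall>Q\<in>row_orbits (H k). card Q = l \<longrightarrow>
          real (\<Sum>z\<in>Q. ddeg (H k) z) = (2 * real a * real b - real a - real b) / real g) \<and>
       (\<forall>Q'\<in>row_orbits (H k). card Q' = l + 1 \<longrightarrow>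
          real (\<Sum>z\<in>Q'. ddeg (H k) z) = (2 * real a * real b - real a - real b) / real g + 1) \<and>
       (\<forall>k'. k' \<le> b - 1 \<and> (a = 1 \<longrightarrow> k' = 0) \<longrightarrow>
          same_orbit_sums (H k) (ddeg (H k)) (H k') (ddeg (H k'))) \<and>
       homometric (H k) (ddeg (H k))) \<and>

     ((\<forall>Q\<in>row_orbits (H k). card Q = l \<longrightarrow>
          real (\<Sum>z\<in>Q. peak z) = (3 * real a * real b - 2 * real a - 2 * real b) / real g) \<and>
       (\<forall>Q'\<in>row_orbits (H k). card Q' = l + 1 \<longrightarrow>
          real (\<Sum>z\<in>Q'. peak z) = (3 * real a * real b - 2 * real a - 2 * real b) / real g + 2) \<and>
       (\<forall>k'. k' \<le> b - 1 \<and> (a = 1 \<longrightarrow> k' = 0) \<longrightarrow>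
          same_orbit_sums (H k) peak (H k') peak) \<and>
       homometric (H k) peak) \<and>

     ((\<forall>Q\<in>row_orbits (H k). card Q = l \<longrightarrow>
          real (\<Sum>z\<in>Q. val z) = (2 * real a * real b - real a - real b) / real g) \<and>
       (\<forall>Q'\<in>row_orbits (H k). card Q' = l + 1 \<longrightarrow>
          real (\<Sum>z\<in>Q'. val z) = (2 * real a * real b - real a - real b) / real g + 1) \<and>
       (\<forall>k'. k' \<le> b - 1 \<and> (a = 1 \<longrightarrow> k' = 0) \<longrightarrow>
          same_orbit_sums (H k) val (H k') val) \<and>
       homometric (H k) val) \<and>

     (k = b - 1 \<longrightarrow>
       (\<forall>Q\<in>row_orbits (H k). card Q = l \<longrightarrow>
          real (\<Sum>z\<in>Q. area \<nu> z) = real l * ((real a + real b - 2) / 2 + 1 / real a)) \<and>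
       (\<forall>Q'\<in>row_orbits (H k). card Q' = l + 1 \<longrightarrow>
          real (\<Sum>z\<in>Q'. area \<nu> z) =
            real l * ((real a + real b - 2) / 2 + 1 / real a) + (real a - 1)) \<and>
       homometric (H k) (area \<nu>)) \<and>

     (k = 0 \<longrightarrow>
       (\<forall>Q\<in>row_orbits (H k). card Q = l \<longrightarrow>
          real (\<Sum>z\<in>Q. area \<nu> z) = real l * ((real a + real b - 2) / 2)) \<and>
       (\<forall>Q'\<in>row_orbits (H k). card Q' = l + 1 \<longrightarrow>
          real (\<Sum>z\<in>Q'. area \<nu> z) =
            real l * ((real a + real b - 2) / 2) + (real a + real b - 1)) \<and>
       homometric (H k) (area \<nu>))"
proof -
  have k: "k < b" and b: "k' \<le> b - 1 \<Longrightarrow> k' < b" for k' using assms(2,3) by auto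
  note eqs = assms(5-8)
  note sizes = alt_hook_row_orbit_sizes[OF assms(1) k assms(4)]
  note ddeg = alt_hook_sum_ddeg[OF assms(1)] and peak = alt_hook_sum_peak[OF assms(1)]
    and val = alt_hook_sum_val[OF assms(1)]
  note area_0 = alt_hook_sum_area_0[OF assms(1) k assms(4)] and area_max = alt_hook_sum_area_max[OF assms(1) k assms(4)]
  show ?thesis
    unfolding eqs homometric_def
  proof (intro conjI ballI allI impI)
    fix Q assume "Q \<in> row_orbits (alt_hook_Tamari a b k)"
    then show "card Q = lcm a b \<or> card Q = lcm a b + 1" by (rule sizes(1))
  next
    fix k' assume "k' \<le> b - 1 \<and> (a = 1 \<longrightarrow> k' = 0)"
    then have k': "k' < b" "a = 1 \<longrightarrow> k' = 0" using b by auto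
    show "same_orbit_sums (alt_hook_Tamari a b k) (ddeg (alt_hook_Tamari a b k))
        (alt_hook_Tamari a b k') (ddeg (alt_hook_Tamari a b k'))"
      using ddeg[OF k assms(4)] ddeg[OF k'] by (rule same_orbit_sumsI)
    show "same_orbit_sums (alt_hook_Tamari a b k) peak (alt_hook_Tamari a b k') peak"
      using peak[OF k assms(4)] peak[OF k'] by (rule same_orbit_sumsI)
    show "same_orbit_sums (alt_hook_Tamari a b k) val (alt_hook_Tamari a b k') val"
      using val[OF k assms(4)] val[OF k'] by (rule same_orbit_sumsI)
  next
    show "same_orbit_sums (alt_hook_Tamari a b k) (ddeg (alt_hook_Tamari a b k))
        (alt_hook_Tamari a b k) (ddeg (alt_hook_Tamari a b k))"
      using ddeg[OF k assms(4)] ddeg[OF k assms(4)] by (rule same_orbit_sumsI)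
    show "same_orbit_sums (alt_hook_Tamari a b k) peak (alt_hook_Tamari a b k) peak"
      using peak[OF k assms(4)] peak[OF k assms(4)] by (rule same_orbit_sumsI)
    show "same_orbit_sums (alt_hook_Tamari a b k) val (alt_hook_Tamari a b k) val"
      using val[OF k assms(4)] val[OF k assms(4)] by (rule same_orbit_sumsI)
    show "same_orbit_sums (alt_hook_Tamari a b k) (area (hook a b)) (alt_hook_Tamari a b k) (area (hook a b))"
      if "k = 0"
      using area_0[OF _ that] area_0[OF _ that] by (rule same_orbit_sumsI)
    show "same_orbit_sums (alt_hook_Tamari a b k) (area (hook a b)) (alt_hook_Tamari a b k) (area (hook a b))"
      if "k = b - 1"
      using area_max[OF _ that] area_max[OF _ that] by (rule same_orbit_sumsI)
  next
    fix Q assume Q: "Q \<in> row_orbits (alt_hook_Tamari a b k)" "card Q = lcm a b"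
    show "real (\<Sum>z\<in>Q. ddeg (alt_hook_Tamari a b k) z) = (2 * real a * real b - real a - real b) / real (gcd a b)"
      using ddeg[OF k assms(4) Q(1)] unfolding if_P[OF Q(2)] by (simp only: add_0_right)
  next
    fix Q assume Q: "Q \<in> row_orbits (alt_hook_Tamari a b k)" "card Q = lcm a b + 1"
    then have small: "card Q \<noteq> lcm a b" by simp
    show "real (\<Sum>z\<in>Q. ddeg (alt_hook_Tamari a b k) z) = (2 * real a * real b - real a - real b) / real (gcd a b) + 1"
      using ddeg[OF k assms(4) Q(1)] unfolding if_not_P[OF small] .
  next
    fix Q assume Q: "Q \<in> row_orbits (alt_hook_Tamari a b k)" "card Q = lcm a b"
    show "real (\<Sum>z\<in>Q. peak z) = (3 * real a * real b - 2 * real a - 2 * real b) / real (gcd a b)"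
      using peak[OF k assms(4) Q(1)] unfolding if_P[OF Q(2)] by (simp only: add_0_right)
  next
    fix Q assume Q: "Q \<in> row_orbits (alt_hook_Tamari a b k)" "card Q = lcm a b + 1"
    then have small: "card Q \<noteq> lcm a b" by simp
    show "real (\<Sum>z\<in>Q. peak z) = (3 * real a * real b - 2 * real a - 2 * real b) / real (gcd a b) + 2"
      using peak[OF k assms(4) Q(1)] unfolding if_not_P[OF small] .
  next
    fix Q assume Q: "Q \<in> row_orbits (alt_hook_Tamari a b k)" "card Q = lcm a b"
    show "real (\<Sum>z\<in>Q. val z) = (2 * real a * real b - real a - real b) / real (gcd a b)"
      using val[OF k assms(4) Q(1)] unfolding if_P[OF Q(2)] by (simp only: add_0_right)
  next
    fix Q assume Q: "Q \<in> row_orbits (alt_hook_Tamari a b k)" "card Q = lcm a b + 1"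
    then have small: "card Q \<noteq> lcm a b" by simp
    show "real (\<Sum>z\<in>Q. val z) = (2 * real a * real b - real a - real b) / real (gcd a b) + 1"
      using val[OF k assms(4) Q(1)] unfolding if_not_P[OF small] .
  next
    assume k': "k = b - 1"
    fix Q assume Q: "Q \<in> row_orbits (alt_hook_Tamari a b k)" "card Q = lcm a b"
    show "real (\<Sum>z\<in>Q. area (hook a b) z) = real (lcm a b) * ((real a + real b - 2) / 2 + 1 / real a)"
      using area_max[OF Q(1) k'] unfolding if_P[OF Q(2)] by (simp only: add_0_right)
  next
    assume k': "k = b - 1"
    fix Q assume Q: "Q \<in> row_orbits (alt_hook_Tamari a b k)" "card Q = lcm a b + 1"
    then have small: "card Q \<noteq> lcm a b" by simp
    show "real (\<Sum>z\<in>Q. area (hook a b) z) = real (lcm a b) * ((real a + real b - 2) / 2 + 1 / real a) + (real a - 1)"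
      using area_max[OF Q(1) k'] unfolding if_not_P[OF small] .
  next
    assume k': "k = 0"
    fix Q assume Q: "Q \<in> row_orbits (alt_hook_Tamari a b k)" "card Q = lcm a b"
    show "real (\<Sum>z\<in>Q. area (hook a b) z) = real (lcm a b) * ((real a + real b - 2) / 2)"
      using area_0[OF Q(1) k'] unfolding if_P[OF Q(2)] by (simp only: add_0_right)
  next
    assume k': "k = 0"
    fix Q assume Q: "Q \<in> row_orbits (alt_hook_Tamari a b k)" "card Q = lcm a b + 1"
    then have small: "card Q \<noteq> lcm a b" by simp
    show "real (\<Sum>z\<in>Q. area (hook a b) z) = real (lcm a b) * ((real a + real b - 2) / 2) + (real a + real b - 1)"
      using area_0[OF Q(1) k'] unfolding if_not_P[OF small] .
  qed (fact sizes(2), fact sizes(3))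
qed

end
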